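(* Let $\pi$ be a permutation with Füredi–Hajnal limit $c_\pi$, and let $k\ge 1$. Then for every $n$ and every input sequence $X\in[0,1]^n$ with pairwise distinct entries that avoids $\pi$, we have $$\mathrm{OPT}_k(X)\in\mathcal{O}\!\left(k^{1+\log_{5c_\pi}120}\cdot n^{1/(\lfloor \log_{5c_\pi} k\rfloor+1)}\right).$$
   Context: Two real sequences $(x_1,\dots,x_m)$ and $(y_1,\dots,y_m)$ are order-isomorphic if $x_i<x_j \iff y_i<y_j$ for all $i,j$. A sequence $X$ contains a sequence $Y$ if some (not necessarily contiguous) subsequence of $X$ is order-isomorphic to $Y$; otherwise $X$ avoids $Y$. A permutation $\pi$ of $[m]$ is written as the sequence $\pi_1\pi_2\dots\pi_m$. Füredi–Hajnal limit: a 0-1 matrix $M$ contains a 0-1 matrix $Q$ if $Q$ can be obtained from a submatrix of $M$ (deleting rows and columns) by turning some 1-entries into 0. The permutation matrix of $\pi$ has a 1 in row $\pi_i$ of column $i$ for each $i$ and 0 elsewhere. $\mathrm{ex}_\pi(n)$ is the maximum number of 1-entries in an $n\times n$ 0-1 matrix not containing the permutation matrix of $\pi$, and $c_\pi=\lim_{n\to\infty}\mathrm{ex}_\pi(n)/n$ (this limit exists and is finite). $k$-server on the line: given requests $X=(x_1,\dots,x_n)\in[0,1]^n$ and $k$ servers, let $p_i^j\in[0,1]$ be the position of server $j$ after serving request $i$, with $p_0^j=0$ for all $j$. The positions are a valid solution if for each $i\in[n]$ some $j$ has $p_i^j=x_i$. The cost is $\sum_{i\in[n]}\sum_{j\in[k]}|p_i^j-p_{i-1}^j|$,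 and $\mathrm{OPT}_k(X)$ is the minimum cost of a valid solution. *)

theory Defs
  imports
    Complex_Main
    "HOL-Library.Sublist"
    "HOL-Combinatorics.Multiset_Permutations"
    "Jordan_Normal_Form.DL_Submatrix"
begin

text \<open>Sequences are lists. A permutation of \<open>[m]\<close> is its word \<open>\<pi>\<^sub>1 \<dots> \<pi>\<^sub>m\<close>, i.e.\ an
  element of \<^term>\<open>permutations_of_set {1..m::nat}\<close>; list positions are counted from 0, the
  entries of \<open>\<pi>\<close> from 1.\<close>

definition order_isomorphic :: "'a::linorder list \<Rightarrow> 'b::linorder list \<Rightarrow> bool" where
  "order_isomorphic xs ys \<longleftrightarrow> length xs = length ys \<and>
     (\<forall>i<length xs. \<forall>j<length xs. xs ! i < xs ! j \<longleftrightarrow> ys ! i < ys ! j)"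

definition seq_contains :: "'a::linorder list \<Rightarrow> 'b::linorder list \<Rightarrow> bool" where
  "seq_contains xs ys \<longleftrightarrow> (\<exists>zs. subseq zs xs \<and> order_isomorphic zs ys)"

definition seq_avoids :: "'a::linorder list \<Rightarrow> 'b::linorder list \<Rightarrow> bool" where
  "seq_avoids xs ys \<longleftrightarrow> \<not> seq_contains xs ys"

text \<open>A 0-1 matrix is a \<^typ>\<open>bool mat\<close>, with \<^const>\<open>True\<close> in the role of the entry 1.\<close>

definition mat_contains :: "bool mat \<Rightarrow> bool mat \<Rightarrow> bool" where
  "mat_contains M Q \<longleftrightarrow> (\<exists>I J.
     dim_row (submatrix M I J) = dim_row Q \<and> dim_col (submatrix M I J) = dim_col Q \<and>
     (\<forall>i<dim_row Q. \<forall>j<dim_col Q. Q $$ (i, j) \<longrightarrow> submatrix M I J $$ (i, j)))"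

definition ones :: "bool mat \<Rightarrow> nat" where
  "ones M = card {(i, j). i < dim_row M \<and> j < dim_col M \<and> M $$ (i, j)}"

text \<open>The offset in \<open>i + 1\<close> is due to matrix rows being indexed from 0.\<close>

definition permutation_matrix :: "nat list \<Rightarrow> bool mat" where
  "permutation_matrix \<pi> = mat (length \<pi>) (length \<pi>) (\<lambda>(i, j). i + 1 = \<pi> ! j)"

definition ex :: "nat list \<Rightarrow> nat \<Rightarrow> nat" where
  "ex \<pi> n = Max {ones M | M. M \<in> carrier_mat n n \<and> \<not> mat_contains M (permutation_matrix \<pi>)}"

definition fh_limit :: "nat list \<Rightarrow> real" where
  "fh_limit \<pi> = lim (\<lambda>n. real (ex \<pi> n) / real n)"

text \<open>\<open>p i j\<close> is the position of server \<open>j \<in> {1..k}\<close> after serving request \<open>i \<in> {1..n}\<close>;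
  request \<open>i\<close> is the list element \<open>X ! (i - 1)\<close>.\<close>

definition valid_solution :: "nat \<Rightarrow> real list \<Rightarrow> (nat \<Rightarrow> nat \<Rightarrow> real) \<Rightarrow> bool" where
  "valid_solution k X p \<longleftrightarrow>
     (\<forall>j\<in>{1..k}. p 0 j = 0) \<and>
     (\<forall>i\<in>{1..length X}. \<forall>j\<in>{1..k}. p i j \<in> {0..1}) \<and>
     (\<forall>i\<in>{1..length X}. \<exists>j\<in>{1..k}. p i j = X ! (i - 1))"

definition cost :: "nat \<Rightarrow> real list \<Rightarrow> (nat \<Rightarrow> nat \<Rightarrow> real) \<Rightarrow> real" where
  "cost k X p = (\<Sum>i\<in>{1..length X}. \<Sum>j\<in>{1..k}. \<bar>p i j - p (i - 1) j\<bar>)"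

text \<open>For \<open>k \<ge> 1\<close> and \<open>X \<in> [0,1]\<^sup>n\<close> this infimum is a minimum: the relevant coordinates
  of the valid solutions form a nonempty compact set, on which the cost is continuous.\<close>

definition OPT :: "nat \<Rightarrow> real list \<Rightarrow> real" where
  "OPT k X = Inf {cost k X p | p. valid_solution k X p}"

end

theory Submission
  imports Defs
begin

text \<open>Let \<open>c = fh_limit \<pi>\<close>, \<open>q = \<lfloor>c\<rfloor> + 1\<close> and \<open>L = \<lfloor>log\<^bsub>5c\<^esub> k\<rfloor>\<close>, so that \<open>q\<^sup>L \<le> k\<close>. Cut the interval of
  positions into \<open>s\<close> rows, and cut the request sequence greedily into time slabs that meet exactly
  \<open>q\<close> rows each (the last slab may meet fewer). If there were \<open>t > s\<close> such slabs, the \<open>t q\<close>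
  nonempty cells would give a \<open>\<pi>\<close>-avoiding \<open>t \<times> t\<close> matrix with \<open>t q > c t \<ge> ex \<pi> t\<close> ones; so there are
  at most \<open>s + 1\<close> slabs. Inside a slab, \<open>q\<close> groups of \<open>q\<^sup>L\<^sup>-\<^sup>1\<close> servers take one row each and proceed
  recursively. With \<open>q\<^sup>L\<close> servers this costs at most \<open>n / s\<^sup>L + (4 q)\<^sup>L s\<close>, and \<open>s \<approx> n powr (1 / (L + 1))\<close>
  balances the two terms.

  The bound \<open>ex \<pi> t \<le> c t\<close> and the very existence of \<open>c\<close> follow from Fekete's lemma, since \<open>ex \<pi>\<close> is
  superadditive and, by the Marcus-Tardos argument, linearly bounded.\<close>

section \<open>Patterns in sets of cells and the extremal function\<close>

text \<open>\<open>(r i, c i)\<close> is the (row, column) cell that plays the role of the \<open>i\<close>-th entry of \<open>\<pi>\<close>.\<close>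

definition pattern_in :: "nat list \<Rightarrow> ('a::linorder \<times> 'b::linorder) set \<Rightarrow> bool" where
  "pattern_in \<pi> S \<longleftrightarrow> (\<exists>r c. \<forall>i<length \<pi>. (r i, c i) \<in> S \<and>
     (\<forall>j<length \<pi>. (i < j \<longrightarrow> c i < c j) \<and> (\<pi> ! i < \<pi> ! j \<longrightarrow> r i < r j)))"

lemma pattern_inI:
  assumes "\<And>i. i < length \<pi> \<Longrightarrow> (r i, c i) \<in> S"
    and "\<And>i j. i < j \<Longrightarrow> j < length \<pi> \<Longrightarrow> c i < c j"
    and "\<And>i j. i < length \<pi> \<Longrightarrow> j < length \<pi> \<Longrightarrow> \<pi> ! i < \<pi> ! j \<Longrightarrow> r i < r j"
  shows "pattern_in \<pi> S"
  using assms unfolding pattern_in_def by blast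

lemma pattern_inE:
  assumes "pattern_in \<pi> S"
  obtains r c where "\<And>i. i < length \<pi> \<Longrightarrow> (r i, c i) \<in> S"
    and "\<And>i j. i < j \<Longrightarrow> j < length \<pi> \<Longrightarrow> c i < c j"
    and "\<And>i j. i < length \<pi> \<Longrightarrow> j < length \<pi> \<Longrightarrow> \<pi> ! i < \<pi> ! j \<Longrightarrow> r i < r j"
proof -
  from assms obtain r c where rc: "\<forall>i<length \<pi>. (r i, c i) \<in> S \<and>
     (\<forall>j<length \<pi>. (i < j \<longrightarrow> c i < c j) \<and> (\<pi> ! i < \<pi> ! j \<longrightarrow> r i < r j))"
    unfolding pattern_in_def by blast
  show ?thesis
  proof (rule that[of r c])
    show "c i < c j" if "i < j" "j < length \<pi>" for i j
      using rc less_trans[OF that] that by blast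
  qed (use rc in blast)+
qed

text \<open>Monotone maps reflect strict inequality, so arbitrary preimages of the cells of an
  occurrence form an occurrence again. This serves both for merging rows and columns into blocks and
  for shifting a matrix.\<close>

lemma pattern_in_contract:
  assumes "pattern_in \<pi> (map_prod u v ` S)" and u: "mono u" and v: "mono v"
  shows "pattern_in \<pi> S"
proof -
  obtain r c where rc: "\<And>i. i < length \<pi> \<Longrightarrow> (r i, c i) \<in> map_prod u v ` S"
    "\<And>i j. i < j \<Longrightarrow> j < length \<pi> \<Longrightarrow> c i < c j"
    "\<And>i j. i < length \<pi> \<Longrightarrow> j < length \<pi> \<Longrightarrow> \<pi> ! i < \<pi> ! j \<Longrightarrow> r i < r j"
    using assms(1) by (rule pattern_inE) blast
  have "\<forall>i. \<exists>p. i < length \<pi> \<longrightarrow> p \<in> S \<and> u (fst p) = r i \<and> v (snd p) = c i"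
    using rc(1) by fastforce
  then obtain p where p: "\<And>i. i < length \<pi> \<Longrightarrow> p i \<in> S \<and> u (fst (p i)) = r i \<and> v (snd (p i)) = c i"
    by metis
  show ?thesis
  proof (rule pattern_inI[where r = "\<lambda>i. fst (p i)" and c = "\<lambda>i. snd (p i)"])
    show "(fst (p i), snd (p i)) \<in> S" if "i < length \<pi>" for i
      using p that by simp
    show "snd (p i) < snd (p j)" if "i < j" "j < length \<pi>" for i j
    proof (rule mono_strict_invE[OF v])
      show "v (snd (p i)) < v (snd (p j))"
        using p[of i] p[of j] rc(2)[of i j] that by auto
    qed
    show "fst (p i) < fst (p j)"
      if "i < length \<pi>" "j < length \<pi>" "\<pi> ! i < \<pi> ! j" for i j
    proof (rule mono_strict_invE[OF u])
      show "u (fst (p i)) < u (fst (p j))"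
        using p[of i] p[of j] rc(3)[of i j] that by auto
    qed
  qed
qed

section \<open>Matrix containment expressed through patterns in sets of cells\<close>

text \<open>The entries of \<open>\<pi>\<close> below \<open>v = \<pi> ! i\<close> are exactly
  \<open>1, ..., v - 1\<close>. The count is used as the 0-based index of a selected row inside a
  submatrix.\<close>

lemma card_smaller_entries:
  assumes "distinct \<pi>" "set \<pi> = {1..length \<pi>}" "i < length \<pi>"
  shows "card {j. j < length \<pi> \<and> \<pi> ! j < \<pi> ! i} = \<pi> ! i - 1"
proof -
  have inj: "inj_on ((!) \<pi>) {..<length \<pi>}"
    using assms(1) by (simp add: inj_on_nth)
  have i: "\<pi> ! i \<in> {1..length \<pi>}"
    using assms(2,3) nth_mem by blast
  have "(!) \<pi> ` {j. j < length \<pi> \<and> \<pi> ! j < \<pi> ! i} = {1..<\<pi> ! i}"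
  proof (intro equalityI subsetI)
    fix v assume "v \<in> (!) \<pi> ` {j. j < length \<pi> \<and> \<pi> ! j < \<pi> ! i}"
    then show "v \<in> {1..<\<pi> ! i}"
      using assms(2) nth_mem by fastforce
  next
    fix v assume v: "v \<in> {1..<\<pi> ! i}"
    then have "v \<in> set \<pi>"
      using assms(2) i by auto
    then show "v \<in> (!) \<pi> ` {j. j < length \<pi> \<and> \<pi> ! j < \<pi> ! i}"
      using v by (auto simp: in_set_conv_nth)
  qed
  moreover have "inj_on ((!) \<pi>) {j. j < length \<pi> \<and> \<pi> ! j < \<pi> ! i}"
    using inj by (rule inj_on_subset) auto
  ultimately show ?thesis
    by (metis card_atLeastLessThan card_image)
qed

definition entries :: "bool mat \<Rightarrow> (nat \<times> nat) set" where
  "entries M = {(i, j). i < dim_row M \<and> j < dim_col M \<and> M $$ (i, j)}"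

text \<open>The functions \<open>r\<close> and \<open>c\<close> of an occurrence list the selected
  rows and columns; conversely, \<open>pick\<close> enumerates the selected rows and columns of a
  submatrix increasingly.\<close>

lemma mat_contains_permutation_iff:
  assumes "distinct \<pi>" "set \<pi> = {1..length \<pi>}"
  shows "mat_contains M (permutation_matrix \<pi>) \<longleftrightarrow> pattern_in \<pi> (entries M)"
proof
  let ?m = "length \<pi>"
  have pi_pos: "1 \<le> \<pi> ! j \<and> \<pi> ! j \<le> ?m" if "j < ?m" for j
    using assms(2) that nth_mem by fastforce
  have dims: "dim_row (permutation_matrix \<pi>) = ?m" "dim_col (permutation_matrix \<pi>) = ?m"
    by (simp_all add: permutation_matrix_def)
  have ent: "permutation_matrix \<pi> $$ (i, j) \<longleftrightarrow> i + 1 = \<pi> ! j" if "i < ?m" "j < ?m" for i j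
    using that by (simp add: permutation_matrix_def)
  {
    assume "mat_contains M (permutation_matrix \<pi>)"
    then obtain I J where IJ: "dim_row (submatrix M I J) = ?m" "dim_col (submatrix M I J) = ?m"
      "\<And>i j. i < ?m \<Longrightarrow> j < ?m \<Longrightarrow> permutation_matrix \<pi> $$ (i, j) \<Longrightarrow> submatrix M I J $$ (i, j)"
      unfolding mat_contains_def dims by blast
    let ?I = "{i. i < dim_row M \<and> i \<in> I}" and ?J = "{j. j < dim_col M \<and> j \<in> J}"
    have cards: "card ?I = ?m" "card ?J = ?m"
      using IJ(1,2) by (simp_all add: dim_submatrix)
    show "pattern_in \<pi> (entries M)"
    proof (rule pattern_inI[where r = "\<lambda>j. pick ?I (\<pi> ! j - 1)" and c = "\<lambda>j. pick ?J j"])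
      fix j assume j: "j < ?m"
      have i: "\<pi> ! j - 1 < ?m"
        using pi_pos[OF j] by linarith
      have "submatrix M I J $$ (\<pi> ! j - 1, j)"
        using IJ(3)[OF i j] ent[OF i j] pi_pos[OF j] by simp
      then have "M $$ (pick I (\<pi> ! j - 1), pick J j)"
        using submatrix_index[of "\<pi> ! j - 1" M I j J] cards i j by simp
      \<comment> \<open>\<open>I\<close> and \<open>J\<close> may reach beyond the dimensions of
        \<open>M\<close>, so \<open>pick\<close> is moved to their truncations, whose cardinality is
        the length of \<open>\<pi>\<close>.\<close>
      then have "M $$ (pick ?I (\<pi> ! j - 1), pick ?J j)"
        using pick_reduce_set[of "\<pi> ! j - 1" "dim_row M" I] pick_reduce_set[of j "dim_col M" J]
          cards i j by simp
      moreover have "pick ?I (\<pi> ! j - 1) \<in> ?I" "pick ?J j \<in> ?J"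
        using pick_in_set_le cards i j by metis+
      ultimately show "(pick ?I (\<pi> ! j - 1), pick ?J j) \<in> entries M"
        by (simp add: entries_def)
    next
      fix i j assume "i < j" "j < ?m"
      then show "pick ?J i < pick ?J j"
        using pick_mono_le cards by metis
    next
      fix i j assume *: "i < ?m" "j < ?m" "\<pi> ! i < \<pi> ! j"
      then have "\<pi> ! i - 1 < \<pi> ! j - 1" "\<pi> ! j - 1 < card ?I"
        using pi_pos[of i] pi_pos[of j] cards by linarith+
      then show "pick ?I (\<pi> ! i - 1) < pick ?I (\<pi> ! j - 1)"
        using pick_mono_le by metis
    qed
  next
    assume "pattern_in \<pi> (entries M)"
    then obtain r c where rc: "\<And>i. i < ?m \<Longrightarrow> (r i, c i) \<in> entries M"
      "\<And>i j. i < j \<Longrightarrow> j < ?m \<Longrightarrow> c i < c j"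
      "\<And>i j. i < ?m \<Longrightarrow> j < ?m \<Longrightarrow> \<pi> ! i < \<pi> ! j \<Longrightarrow> r i < r j"
      by (rule pattern_inE) blast
    let ?I = "r ` {..<?m}" and ?J = "c ` {..<?m}"
    have c_iff: "c i < c j \<longleftrightarrow> i < j" if "i < ?m" "j < ?m" for i j
      using rc(2)[of i j] rc(2)[of j i] that by (metis less_asym linorder_neqE)
    have r_iff: "r i < r j \<longleftrightarrow> \<pi> ! i < \<pi> ! j" if "i < ?m" "j < ?m" for i j
      using rc(3)[of i j] rc(3)[of j i] that assms(1)
      by (metis less_asym linorder_neqE nth_eq_iff_index_eq)
    have inj: "inj_on r {..<?m}" "inj_on c {..<?m}"
      using r_iff c_iff assms(1)
      by (auto simp: inj_on_def) (metis linorder_neqE nth_eq_iff_index_eq less_irrefl,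
          metis linorder_neqE less_irrefl)
    have sub: "{i. i < dim_row M \<and> i \<in> ?I} = ?I" "{j. j < dim_col M \<and> j \<in> ?J} = ?J"
      using rc(1) by (auto simp: entries_def)
    have cards: "card ?I = ?m" "card ?J = ?m"
      using inj by (simp_all add: card_image)
    show "mat_contains M (permutation_matrix \<pi>)"
      unfolding mat_contains_def
    proof (intro exI conjI allI impI)
      show "dim_row (submatrix M ?I ?J) = dim_row (permutation_matrix \<pi>)"
        "dim_col (submatrix M ?I ?J) = dim_col (permutation_matrix \<pi>)"
        unfolding dim_submatrix sub cards dims by simp_all
      fix i j assume ij: "i < dim_row (permutation_matrix \<pi>)" "j < dim_col (permutation_matrix \<pi>)"
        "permutation_matrix \<pi> $$ (i, j)"
      then have j: "j < ?m" and i: "i = \<pi> ! j - 1"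
        using dims ent by auto
      \<comment> \<open>Row \<open>r j\<close> has index \<open>\<pi> ! j - 1\<close> in the
        submatrix because exactly that many selected rows have a smaller number.\<close>
      have "{a \<in> ?I. a < r j} = r ` {i. i < ?m \<and> \<pi> ! i < \<pi> ! j}"
        using r_iff j by auto
      moreover have "inj_on r {i. i < ?m \<and> \<pi> ! i < \<pi> ! j}"
        using inj(1) by (rule inj_on_subset) auto
      ultimately have "card {a \<in> ?I. a < r j} = i"
        using card_smaller_entries[OF assms j] i by (simp add: card_image)
      moreover have "{a \<in> ?J. a < c j} = c ` {..<j}"
        using c_iff j by auto
      then have "card {a \<in> ?J. a < c j} = j"
        using inj_on_subset[OF inj(2), of "{..<j}"] j by (simp add: card_image)
      ultimately show "submatrix M ?I ?J $$ (i, j)"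
        using submatrix_index_card[of "r j" M "c j" ?I ?J] rc(1)[OF j] j
        by (auto simp: entries_def)
    qed
  }
qed

text \<open>\<open>Max\<close> in the definition of \<open>ex\<close> is meaningful only over a
  finite set; the number of ones is at most \<open>n * n\<close>.\<close>

lemma finite_ones_avoiding:
  "finite {ones M | M. M \<in> carrier_mat n n \<and> \<not> mat_contains M Q}"
proof (rule finite_subset)
  show "{ones M | M. M \<in> carrier_mat n n \<and> \<not> mat_contains M Q} \<subseteq> {..n * n}"
  proof
    fix x assume "x \<in> {ones M | M. M \<in> carrier_mat n n \<and> \<not> mat_contains M Q}"
    then obtain M where M: "M \<in> carrier_mat n n" "x = ones M"
      by blast
    then have "{(i, j). i < dim_row M \<and> j < dim_col M \<and> M $$ (i, j)} \<subseteq> {..<n} \<times> {..<n}"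
      by auto
    then have "ones M \<le> card ({..<n} \<times> {..<n})"
      unfolding ones_def by (intro card_mono) auto
    then show "x \<in> {..n * n}"
      using M(2) by simp
  qed
qed simp

lemma card_le_ex:
  assumes "distinct \<pi>" "set \<pi> = {1..length \<pi>}"
    and S: "S \<subseteq> {..<n} \<times> {..<n}" "\<not> pattern_in \<pi> S"
  shows "card S \<le> ex \<pi> n"
proof -
  let ?M = "mat n n (\<lambda>p. p \<in> S)"
  have "entries ?M = S"
    using S(1) by (auto simp: entries_def)
  then have "\<not> mat_contains ?M (permutation_matrix \<pi>)" "ones ?M = card S"
    using mat_contains_permutation_iff[OF assms(1,2)] S(2) by (auto simp: entries_def ones_def)
  then have "card S \<in> {ones M | M. M \<in> carrier_mat n n \<and> \<not> mat_contains M (permutation_matrix \<pi>)}"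
    by (metis (mono_tags, lifting) mat_carrier mem_Collect_eq)
  then show ?thesis
    unfolding ex_def by (rule Max_ge[OF finite_ones_avoiding])
qed

text \<open>The zero matrix avoids every nonempty word, so the set under \<open>Max\<close> is
  nonempty. The empty word occurs in every matrix, hence the restriction on
  \<open>\<pi>\<close>.\<close>

lemma ex_attained:
  assumes "distinct \<pi>" "set \<pi> = {1..length \<pi>}" "\<pi> \<noteq> []"
  obtains S where "S \<subseteq> {..<n} \<times> {..<n}" "\<not> pattern_in \<pi> S" "card S = ex \<pi> n"
proof -
  let ?A = "{ones M | M. M \<in> carrier_mat n n \<and> \<not> mat_contains M (permutation_matrix \<pi>)}"
  let ?Z = "mat n n (\<lambda>_. False)"
  have "entries ?Z = {}"
    by (auto simp: entries_def)
  then have "\<not> mat_contains ?Z (permutation_matrix \<pi>)"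
    using mat_contains_permutation_iff[OF assms(1,2)] assms(3) by (auto simp: pattern_in_def)
  then have "?A \<noteq> {}"
    using mat_carrier by blast
  then have "ex \<pi> n \<in> ?A"
    unfolding ex_def by (rule Max_in[OF finite_ones_avoiding])
  then obtain M where M: "M \<in> carrier_mat n n" "\<not> mat_contains M (permutation_matrix \<pi>)"
    "ones M = ex \<pi> n"
    by auto
  show ?thesis
  proof
    show "entries M \<subseteq> {..<n} \<times> {..<n}"
      using M(1) by (auto simp: entries_def)
    show "\<not> pattern_in \<pi> (entries M)"
      using M(2) mat_contains_permutation_iff[OF assms(1,2)] by simp
    show "card (entries M) = ex \<pi> n"
      using M(3) by (simp add: entries_def ones_def)
  qed
qed

section \<open>Full grids\<close>

text \<open>A full grid contains every permutation: column \<open>i\<close> of the grid uses row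
  \<open>\<pi> ! i - 1\<close>, the shift being due to entries counted from 1. The grid may lie in a
  monotone image of \<open>S\<close>, which covers grids whose rows or columns are blocks.\<close>

lemma pattern_in_grid:
  fixes u :: "'a::linorder \<Rightarrow> 'c::linorder" and v :: "'b::linorder \<Rightarrow> 'd::linorder"
  assumes "distinct \<pi>" "set \<pi> = {1..length \<pi>}"
    and e: "\<And>i j. i < j \<Longrightarrow> j < length \<pi> \<Longrightarrow> e i < e j"
    and f: "\<And>i j. i < j \<Longrightarrow> j < length \<pi> \<Longrightarrow> f i < f j"
    and S: "\<And>i j. i < length \<pi> \<Longrightarrow> j < length \<pi> \<Longrightarrow> (e i, f j) \<in> map_prod u v ` S"
    and u: "mono u" and v: "mono v"
  shows "pattern_in \<pi> S"
proof (rule pattern_in_contract[OF _ u v])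
  have pi_pos: "1 \<le> \<pi> ! j \<and> \<pi> ! j \<le> length \<pi>" if "j < length \<pi>" for j
    using assms(2) that nth_mem by fastforce
  show "pattern_in \<pi> (map_prod u v ` S)"
  proof (rule pattern_inI[where r = "\<lambda>i. e (\<pi> ! i - 1)" and c = f])
    show "(e (\<pi> ! i - 1), f i) \<in> map_prod u v ` S" if "i < length \<pi>" for i
      using S[of "\<pi> ! i - 1" i] pi_pos[OF that] that by linarith
    show "f i < f j" if "i < j" "j < length \<pi>" for i j
      using that by (rule f)
    show "e (\<pi> ! i - 1) < e (\<pi> ! j - 1)"
      if "i < length \<pi>" "j < length \<pi>" "\<pi> ! i < \<pi> ! j" for i j
      using pi_pos[of i] pi_pos[of j] that by (intro e) linarith+
  qed
qed

text \<open>Pigeonhole: \<open>E\<close> has \<open>2 ^ card E\<close> subsets, so more than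
  \<open>k\<close> elements of \<open>A\<close> share the same set \<open>D\<close> of related
  elements, and \<open>D\<close> has at least \<open>k\<close> members. The first \<open>k\<close>
  elements on either side span the grid.\<close>

lemma dense_grid:
  fixes A E :: "nat set"
  assumes fin: "finite A" "finite E" and A: "k * 2 ^ card E < card A"
    and Q: "\<And>a. a \<in> A \<Longrightarrow> k \<le> card {d \<in> E. Q a d}"
  obtains e f :: "nat \<Rightarrow> nat" where "\<And>i j. i < j \<Longrightarrow> j < k \<Longrightarrow> e i < e j"
    "\<And>i j. i < j \<Longrightarrow> j < k \<Longrightarrow> f i < f j" "\<And>i j. i < k \<Longrightarrow> j < k \<Longrightarrow> Q (e i) (f j)"
proof -
  let ?D = "\<lambda>a. {d \<in> E. Q a d}"
  obtain D where D: "D \<in> Pow E" "card A \<le> card (?D -` {D} \<inter> A) * card (Pow E)"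
    using pigeonhole_card[of ?D A "Pow E"] fin by auto
  have "?D -` {D} \<inter> A = {a \<in> A. ?D a = D}"
    by blast
  with D fin A have "k * 2 ^ card E < card {a \<in> A. ?D a = D} * 2 ^ card E"
    by (simp only: card_Pow)
  with D(1) have D: "D \<subseteq> E" "k < card {a \<in> A. ?D a = D}"
    by simp_all
  let ?A = "{a \<in> A. ?D a = D}"
  obtain a where "a \<in> ?A"
    using D(2) by (metis (no_types, lifting) all_not_in_conv card.empty not_less_zero)
  then have kD: "k \<le> card D"
    using Q by force
  have e: "pick ?A i \<in> ?A" if "i < k" for i
    using that D(2) by (intro pick_in_set_le) simp
  have f: "pick D i \<in> D" if "i < k" for i
    using that kD by (intro pick_in_set_le) simp
  show ?thesis
  proof
    show "pick ?A i < pick ?A j" if "i < j" "j < k" for i j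
      using that D(2) by (intro pick_mono_le) simp_all
    show "pick D i < pick D j" if "i < j" "j < k" for i j
      using that kD by (intro pick_mono_le) simp_all
    show "Q (pick ?A i) (pick D j)" if "i < k" "j < k" for i j
      using e[OF that(1)] f[OF that(2)] by blast
  qed
qed

section \<open>The Marcus-Tardos bound and the Fueredi-Hajnal limit\<close>

lemma mono_div_nat: "mono (\<lambda>i::nat. i div w)"
  by (simp add: monoI div_le_mono)

lemma div_fiber:
  assumes "0 < (w::nat)"
  shows "{i. i div w = a} = {a * w..<a * w + w}"
proof (intro equalityI subsetI)
  fix i assume "i \<in> {i. i div w = a}"
  then show "i \<in> {a * w..<a * w + w}"
    using dividend_less_div_times[OF assms, of i] div_times_less_eq_dividend[of i w] by auto
next
  fix i assume "i \<in> {a * w..<a * w + w}"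
  then show "i \<in> {i. i div w = a}"
    by (auto intro: div_nat_eqI simp: mult.commute)
qed

text \<open>\<open>S\<close> is cut into \<open>w \<times> w\<close> blocks. A block meeting fewer
  than \<open>k\<close> rows and fewer than \<open>k\<close> columns has at most
  \<open>(k - 1) * (k - 1)\<close> entries. The others, wide (\<open>W\<close>) or high
  (\<open>H\<close>), are few: too many wide blocks in one column of blocks, or high blocks in one
  row of blocks, would yield a full grid and hence \<open>\<pi>\<close>.\<close>

lemma marcus_tardos_step:
  fixes S :: "(nat \<times> nat) set"
  assumes pi: "distinct \<pi>" "set \<pi> = {1..length \<pi>}"
    and k: "k = length \<pi>" "0 < k" and w: "w = k * k"
    and S: "S \<subseteq> {..<w * N} \<times> {..<w * N}" "\<not> pattern_in \<pi> S"
    and B: "card (map_prod (\<lambda>i. i div w) (\<lambda>j. j div w) ` S) \<le> B"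
  shows "card S \<le> (k - 1) * (k - 1) * B + 2 * N * (k * 2 ^ w) * (w * w)"
proof -
  let ?u = "\<lambda>i. i div w"
  let ?b = "map_prod ?u ?u"
  let ?T = "?b ` S"
  define blk where "blk = (\<lambda>\<beta>. {p \<in> S. ?b p = \<beta>})"
  define W where "W = {\<beta> \<in> ?T. k \<le> card (snd ` blk \<beta>)}"
  define H where "H = {\<beta> \<in> ?T. k \<le> card (fst ` blk \<beta>)}"
  have w0: "0 < w"
    using k w by simp
  have finS: "finite S"
    using S(1) by (rule finite_subset) simp
  have T: "?T \<subseteq> {..<N} \<times> {..<N}"
    using S(1) by (auto simp: less_mult_imp_div_less mult.commute)
  have cardE: "card {i. i div w = a} = w" "finite {i. i div w = a}" for a
    using div_fiber[OF w0, of a] by simp_all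
  have no_grid: False if "\<And>i j. i < j \<Longrightarrow> j < k \<Longrightarrow> e i < e j" "\<And>i j. i < j \<Longrightarrow> j < k \<Longrightarrow> f i < f j"
    "\<And>i j. i < k \<Longrightarrow> j < k \<Longrightarrow> (e i, f j) \<in> map_prod u v ` S" "mono u" "mono v"
    for e f u v :: "nat \<Rightarrow> nat"
    using pattern_in_grid[OF pi, of e f u v S] that k S(2) by blast
  have mono_idn: "mono (id :: nat \<Rightarrow> nat)"
    by (simp add: mono_def)
  have W_col: "card {a. (a, b) \<in> W} \<le> k * 2 ^ w" for b
  proof (rule ccontr)
    assume "\<not> ?thesis"
    then have big: "k * 2 ^ card {i. i div w = b} < card {a. (a, b) \<in> W}"
      using cardE by simp
    have fin: "finite {a. (a, b) \<in> W}"
      using big card.infinite by force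
    \<comment> \<open>Merging the rows of each block but keeping single columns turns every wide
      block into a row with at least \<open>k\<close> entries among the \<open>w\<close> columns
      considered.\<close>
    define Q where "Q = (\<lambda>a d. \<exists>i. i div w = a \<and> (i, d) \<in> S)"
    have Q_card: "k \<le> card {d \<in> {i. i div w = b}. Q a d}" if "a \<in> {a. (a, b) \<in> W}" for a
    proof -
      have "snd ` blk (a, b) = {d \<in> {i. i div w = b}. Q a d}"
        by (force simp: blk_def Q_def)
      then show ?thesis
        using that by (simp add: W_def)
    qed
    obtain e f where ef: "\<And>i j. i < j \<Longrightarrow> j < k \<Longrightarrow> e i < e j"
      "\<And>i j. i < j \<Longrightarrow> j < k \<Longrightarrow> f i < f j" "\<And>i j. i < k \<Longrightarrow> j < k \<Longrightarrow> Q (e i) (f j)"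
      by (rule dense_grid[OF fin cardE(2) big Q_card]) blast+
    have grid: "(e i, f j) \<in> map_prod ?u id ` S" if "i < k" "j < k" for i j
      using ef(3)[OF that] by (force simp: Q_def)
    show False
      by (rule no_grid[where e = e and f = f and u = ?u and v = id];
          fact ef(1) ef(2) grid mono_div_nat mono_idn)
  qed
  have H_row: "card {b. (a, b) \<in> H} \<le> k * 2 ^ w" for a
  proof (rule ccontr)
    assume "\<not> ?thesis"
    then have big: "k * 2 ^ card {i. i div w = a} < card {b. (a, b) \<in> H}"
      using cardE by simp
    have fin: "finite {b. (a, b) \<in> H}"
      using big card.infinite by force
    \<comment> \<open>Transposed argument: columns are merged and rows kept, so \<open>e\<close>
      will list columns of blocks and \<open>f\<close> single rows.\<close>
    define Q where "Q = (\<lambda>b d. \<exists>j. j div w = b \<and> (d, j) \<in> S)"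
    have Q_card: "k \<le> card {d \<in> {i. i div w = a}. Q b d}" if "b \<in> {b. (a, b) \<in> H}" for b
    proof -
      have "fst ` blk (a, b) = {d \<in> {i. i div w = a}. Q b d}"
        by (force simp: blk_def Q_def)
      then show ?thesis
        using that by (simp add: H_def)
    qed
    obtain e f where ef: "\<And>i j. i < j \<Longrightarrow> j < k \<Longrightarrow> e i < e j"
      "\<And>i j. i < j \<Longrightarrow> j < k \<Longrightarrow> f i < f j" "\<And>i j. i < k \<Longrightarrow> j < k \<Longrightarrow> Q (e i) (f j)"
      by (rule dense_grid[OF fin cardE(2) big Q_card]) blast+
    have grid: "(f i, e j) \<in> map_prod id ?u ` S" if "i < k" "j < k" for i j
      using ef(3)[OF that(2,1)] by (force simp: Q_def)
    show False
      by (rule no_grid[where e = f and f = e and u = id and v = ?u];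
          fact ef(1) ef(2) grid mono_div_nat mono_idn)
  qed
  have "W = (\<Union>b<N. (\<lambda>a. (a, b)) ` {a. (a, b) \<in> W})"
    using T by (fastforce simp: W_def)
  then have "card W \<le> (\<Sum>b<N. card ((\<lambda>a. (a, b)) ` {a. (a, b) \<in> W}))"
    using card_UN_le[of "{..<N}" "\<lambda>b. (\<lambda>a. (a, b)) ` {a. (a, b) \<in> W}"] by simp
  also have "\<dots> \<le> (\<Sum>b<N. k * 2 ^ w)"
    by (rule sum_mono) (use W_col in \<open>simp add: card_image inj_on_def\<close>)
  finally have cardW: "card W \<le> N * (k * 2 ^ w)"
    by simp
  have "H = (\<Union>a<N. Pair a ` {b. (a, b) \<in> H})"
    using T by (fastforce simp: H_def)
  then have "card H \<le> (\<Sum>a<N. card (Pair a ` {b. (a, b) \<in> H}))"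
    using card_UN_le[of "{..<N}" "\<lambda>a. Pair a ` {b. (a, b) \<in> H}"] by simp
  also have "\<dots> \<le> (\<Sum>a<N. k * 2 ^ w)"
    by (rule sum_mono) (use H_row in \<open>simp add: card_image inj_on_def\<close>)
  finally have cardH: "card H \<le> N * (k * 2 ^ w)"
    by simp
  have finT: "finite ?T"
    using finS by simp
  \<comment> \<open>Wide and high blocks are charged all their \<open>w * w\<close> cells; any other
    block lies in the product of its two small projections.\<close>
  have blk_le: "card (blk \<beta>) \<le> (k - 1) * (k - 1) + (if \<beta> \<in> W \<union> H then w * w else 0)"
    if "\<beta> \<in> ?T" for \<beta>
  proof (cases "\<beta> \<in> W \<union> H")
    case True
    have "blk \<beta> \<subseteq> {i. i div w = fst \<beta>} \<times> {i. i div w = snd \<beta>}"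
      by (auto simp: blk_def)
    then have "card (blk \<beta>) \<le> card ({i. i div w = fst \<beta>} \<times> {i. i div w = snd \<beta>})"
      by (intro card_mono finite_cartesian_product cardE)
    then show ?thesis
      using True by (simp add: card_cartesian_product cardE)
  next
    case False
    have fin: "finite (blk \<beta>)"
      using finS by (simp add: blk_def)
    have "blk \<beta> \<subseteq> fst ` blk \<beta> \<times> snd ` blk \<beta>"
      by force
    then have "card (blk \<beta>) \<le> card (fst ` blk \<beta> \<times> snd ` blk \<beta>)"
      using fin by (intro card_mono) auto
    also have "\<dots> = card (fst ` blk \<beta>) * card (snd ` blk \<beta>)"
      by (rule card_cartesian_product)
    also have "\<dots> \<le> (k - 1) * (k - 1)"
      using False that by (intro mult_mono) (auto simp: W_def H_def)
    finally show ?thesis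
      by simp
  qed
  have "S = (\<Union>\<beta>\<in>?T. blk \<beta>)"
    by (auto simp: blk_def)
  then have "card S \<le> (\<Sum>\<beta>\<in>?T. card (blk \<beta>))"
    using card_UN_le[OF finT, of blk] by simp
  also have "\<dots> \<le> (\<Sum>\<beta>\<in>?T. (k - 1) * (k - 1) + (if \<beta> \<in> W \<union> H then w * w else 0))"
    by (rule sum_mono) (rule blk_le)
  also have "\<dots> = (k - 1) * (k - 1) * card ?T + card (W \<union> H) * (w * w)"
  proof -
    have "?T \<inter> (W \<union> H) = W \<union> H"
      by (auto simp: W_def H_def)
    then have "(\<Sum>\<beta>\<in>?T. if \<beta> \<in> W \<union> H then w * w else 0) = card (W \<union> H) * (w * w)"
      using sum.inter_restrict[OF finT, of "\<lambda>_. w * w" "W \<union> H"] by simp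
    then show ?thesis
      by (simp add: sum.distrib mult.commute del: Un_iff)
  qed
  also have "\<dots> \<le> (k - 1) * (k - 1) * B + 2 * N * (k * 2 ^ w) * (w * w)"
    using B cardW cardH card_Un_le[of W H] by (intro add_mono mult_mono) auto
  finally show ?thesis .
qed

text \<open>\<open>K\<close> is chosen so that the wide and high blocks contribute
  \<open>K * w ^ i\<close>. The recurrence then closes because
  \<open>(k - 1) * (k - 1) + 1 \<le> k * k = w\<close>.\<close>

lemma marcus_tardos_power:
  fixes S :: "(nat \<times> nat) set"
  assumes pi: "distinct \<pi>" "set \<pi> = {1..length \<pi>}"
    and k: "k = length \<pi>" "0 < k" and w: "w = k * k"
    and K: "K = 2 * (k * 2 ^ w) * (w * w)"
    and S: "S \<subseteq> {..<w ^ i} \<times> {..<w ^ i}" "\<not> pattern_in \<pi> S"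
  shows "card S \<le> K * w ^ i"
  using S
proof (induction i arbitrary: S)
  case 0
  then have "card S \<le> card ({..<1::nat} \<times> {..<1::nat})"
    by (intro card_mono) auto
  moreover have "1 \<le> K"
    using k w K by (simp add: Suc_le_eq)
  ultimately show ?case
    by simp
next
  case (Suc i)
  let ?T = "map_prod (\<lambda>i. i div w) (\<lambda>j. j div w) ` S"
  have "?T \<subseteq> {..<w ^ i} \<times> {..<w ^ i}"
    using Suc.prems(1) by (auto simp: less_mult_imp_div_less mult.commute)
  moreover have "\<not> pattern_in \<pi> ?T"
    using Suc.prems(2) pattern_in_contract mono_div_nat by blast
  ultimately have "card ?T \<le> K * w ^ i"
    by (rule Suc.IH)
  then have "card S \<le> (k - 1) * (k - 1) * (K * w ^ i) + 2 * w ^ i * (k * 2 ^ w) * (w * w)"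
    using Suc.prems by (intro marcus_tardos_step[OF pi k w]) simp_all
  also have "\<dots> = ((k - 1) * (k - 1) + 1) * (K * w ^ i)"
    by (simp add: K algebra_simps)
  also have "\<dots> \<le> w * (K * w ^ i)"
    using k(2) unfolding w by (cases k) (intro mult_right_mono, auto)
  finally show ?case
    by (simp add: ac_simps)
qed

text \<open>Enlarging the side \<open>n\<close> to the next power of \<open>w\<close> costs only a
  factor \<open>w\<close>, which is absorbed into the constant.\<close>

lemma marcus_tardos:
  assumes pi: "distinct \<pi>" "set \<pi> = {1..length \<pi>}" "2 \<le> length \<pi>"
  obtains K where "\<And>n. ex \<pi> n \<le> K * n"
proof -
  define k where "k = length \<pi>"
  define w where "w = k * k"
  define K where "K = 2 * (k * 2 ^ w) * (w * w)"
  have k: "2 \<le> k"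
    using pi(3) by (simp add: k_def)
  then have k0: "0 < k"
    by linarith
  have "2 * 1 \<le> w"
    unfolding w_def using k by (intro mult_mono) auto
  then have w: "2 \<le> w"
    by simp
  have "ex \<pi> n \<le> K * w * n" for n
  proof -
    have "\<pi> \<noteq> []"
      using pi(3) by (cases \<pi>) auto
    then obtain S where S: "S \<subseteq> {..<n} \<times> {..<n}" "\<not> pattern_in \<pi> S" "card S = ex \<pi> n"
      by (rule ex_attained[OF pi(1,2)])
    show ?thesis
    proof (cases "n = 0")
      case True
      then have "S = {}"
        using S(1) by simp
      then show ?thesis
        using S(3) by simp
    next
      case False
      then obtain i where i: "w ^ i \<le> n" "n < w ^ (i + 1)"
        using ex_power_ivl1[OF w, of n] by auto
      have "S \<subseteq> {..<w ^ (i + 1)} \<times> {..<w ^ (i + 1)}"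
        using S(1) i(2) by fastforce
      then have "card S \<le> K * w ^ (i + 1)"
        using S(2) by (intro marcus_tardos_power[OF pi(1,2) k_def k0 w_def K_def])
      also have "\<dots> = K * w * w ^ i"
        by simp
      also have "\<dots> \<le> K * w * n"
        using i(1) by (rule mult_left_mono) simp
      finally show ?thesis
        using S(3) by simp
    qed
  qed
  then show ?thesis
    by (rule that)
qed

section \<open>Superadditivity and Fekete's lemma\<close>

text \<open>If the first cell of an occurrence were not in \<open>U\<close>, all its columns would
  be at least \<open>d\<close> and the occurrence would lie in \<open>V\<close>; symmetrically for
  the last cell. So the occurrence starts in \<open>U\<close> and ends in \<open>V\<close>, and
  these two rows compare like the first and last entries of \<open>\<pi>\<close>.\<close>

lemma pattern_in_split_columns:
  fixes U V :: "('a::linorder \<times> 'b::linorder) set"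
  assumes pat: "pattern_in \<pi> (U \<union> V)" and U: "\<not> pattern_in \<pi> U" and V: "\<not> pattern_in \<pi> V"
    and U_lt: "\<And>r c. (r, c) \<in> U \<Longrightarrow> c < d" and V_ge: "\<And>r c. (r, c) \<in> V \<Longrightarrow> d \<le> c"
    and m: "2 \<le> length \<pi>"
  obtains r c r' c' where "(r, c) \<in> U" "(r', c') \<in> V"
    "\<pi> ! 0 < last \<pi> \<Longrightarrow> r < r'" "last \<pi> < \<pi> ! 0 \<Longrightarrow> r' < r"
proof -
  let ?z = "length \<pi> - 1"
  obtain r c where rc: "\<And>i. i < length \<pi> \<Longrightarrow> (r i, c i) \<in> U \<union> V"
    "\<And>i j. i < j \<Longrightarrow> j < length \<pi> \<Longrightarrow> c i < c j"
    "\<And>i j. i < length \<pi> \<Longrightarrow> j < length \<pi> \<Longrightarrow> \<pi> ! i < \<pi> ! j \<Longrightarrow> r i < r j"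
    using pat by (rule pattern_inE) blast
  have c_ge: "c 0 \<le> c i" if "i < length \<pi>" for i
    using rc(2)[of 0 i] that by (cases "i = 0") auto
  have c_le: "c i \<le> c ?z" if "i < length \<pi>" for i
  proof (cases "i < ?z")
    case True
    moreover have "?z < length \<pi>"
      using m by linarith
    ultimately show ?thesis
      using rc(2)[of i ?z] by (intro less_imp_le)
  next
    case False
    then have "i = ?z"
      using that by linarith
    then show ?thesis
      by simp
  qed
  have "(r 0, c 0) \<in> U"
  proof (rule ccontr)
    assume "(r 0, c 0) \<notin> U"
    then have "d \<le> c 0"
      using rc(1)[of 0] V_ge m by fastforce
    then have "(r i, c i) \<in> V" if "i < length \<pi>" for i
      using rc(1)[OF that] U_lt c_ge[OF that] by fastforce
    then show False
      using V pattern_inI[of \<pi> r c V] rc(2,3) by blast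
  qed
  moreover have "(r ?z, c ?z) \<in> V"
  proof (rule ccontr)
    assume "(r ?z, c ?z) \<notin> V"
    then have "c ?z < d"
      using rc(1)[of ?z] U_lt m by fastforce
    then have "(r i, c i) \<in> U" if "i < length \<pi>" for i
      using rc(1)[OF that] V_ge c_le[OF that] by fastforce
    then show False
      using U pattern_inI[of \<pi> r c U] rc(2,3) by blast
  qed
  moreover have last: "last \<pi> = \<pi> ! ?z"
    using m by (cases \<pi>) (auto simp: last_conv_nth)
  moreover have "\<pi> ! 0 < last \<pi> \<Longrightarrow> r 0 < r ?z" "last \<pi> < \<pi> ! 0 \<Longrightarrow> r ?z < r 0"
    unfolding last using m by (auto intro!: rc(3))
  ultimately show ?thesis
    using that by blast
qed

lemma ex_superadditive:
  assumes pi: "distinct \<pi>" "set \<pi> = {1..length \<pi>}" "2 \<le> length \<pi>"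
  shows "ex \<pi> a + ex \<pi> b \<le> ex \<pi> (a + b)"
proof -
  have ne: "\<pi> \<noteq> []"
    using pi(3) by (cases \<pi>) auto
  obtain A where A: "A \<subseteq> {..<a} \<times> {..<a}" "\<not> pattern_in \<pi> A" "card A = ex \<pi> a"
    using ex_attained[OF pi(1,2) ne] by blast
  obtain B where B: "B \<subseteq> {..<b} \<times> {..<b}" "\<not> pattern_in \<pi> B" "card B = ex \<pi> b"
    using ex_attained[OF pi(1,2) ne] by blast
  have "last \<pi> \<noteq> \<pi> ! 0"
    using pi(1,3) ne by (simp add: last_conv_nth nth_eq_iff_index_eq)
  \<comment> \<open>Place the two extremal matrices on the diagonal if \<open>\<pi>\<close> ends below its first entry, and on
    the antidiagonal otherwise; then no occurrence of \<open>\<pi>\<close> can use both of them.\<close>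
  define x y where "x = (if last \<pi> < \<pi> ! 0 then 0 else b)"
    and "y = (if last \<pi> < \<pi> ! 0 then a else 0)"
  define U where "U = map_prod (\<lambda>i. i + x) id ` A"
  define V where "V = map_prod (\<lambda>i. i + y) (\<lambda>j. j + a) ` B"
  have UV: "\<not> pattern_in \<pi> U" "\<not> pattern_in \<pi> V"
    using A(2) B(2) pattern_in_contract[of \<pi> "\<lambda>i. i + x" id A]
      pattern_in_contract[of \<pi> "\<lambda>i. i + y" "\<lambda>j. j + a" B]
    by (auto simp: U_def V_def mono_def)
  have "\<not> pattern_in \<pi> (U \<union> V)"
  proof
    assume "pattern_in \<pi> (U \<union> V)"
    then obtain r c r' c' where "(r, c) \<in> U" "(r', c') \<in> V"
      "\<pi> ! 0 < last \<pi> \<Longrightarrow> r < r'" "last \<pi> < \<pi> ! 0 \<Longrightarrow> r' < r"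
    proof (rule pattern_in_split_columns[where d = a, OF _ UV _ _ pi(3)])
      show "c < a" if "(r, c) \<in> U" for r c
        using that A(1) by (auto simp: U_def)
      show "a \<le> c" if "(r, c) \<in> V" for r c
        using that by (auto simp: V_def)
    qed blast
    then show False
      using A(1) B(1) \<open>last \<pi> \<noteq> \<pi> ! 0\<close>
      by (cases "last \<pi> < \<pi> ! 0") (fastforce simp: U_def V_def x_def y_def)+
  qed
  moreover have "U \<union> V \<subseteq> {..<a + b} \<times> {..<a + b}"
    using A(1) B(1) by (force simp: U_def V_def x_def y_def split: if_splits)
  ultimately have "card (U \<union> V) \<le> ex \<pi> (a + b)"
    by (intro card_le_ex[OF pi(1,2)])
  moreover have "card (U \<union> V) = card U + card V"
  proof (rule card_Un_disjoint)
    show "finite U" "finite V"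
      using finite_subset[OF A(1)] finite_subset[OF B(1)] by (simp_all add: U_def V_def)
    show "U \<inter> V = {}"
      using A(1) by (fastforce simp: U_def V_def)
  qed
  moreover have "card U = card A" "card V = card B"
    unfolding U_def V_def by (auto intro!: card_image simp: inj_on_def)
  ultimately show ?thesis
    using A(3) B(3) by simp
qed

text \<open>The limit is the supremum of \<open>a n / n\<close>, which gives the bound for every
  \<open>n\<close> at once. For fixed \<open>N\<close>, superadditivity over \<open>n div N\<close>
  copies of \<open>N\<close> yields \<open>a n / n \<ge> a N / N - a N / n\<close>, and the last
  term vanishes.\<close>

lemma fekete:
  fixes a :: "nat \<Rightarrow> real"
  assumes nonneg: "\<And>n. 0 \<le> a n" and super: "\<And>m n. a m + a n \<le> a (m + n)"
    and bound: "\<And>n. a n \<le> K * real n"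
  obtains c where "(\<lambda>n. a n / real n) \<longlonglongrightarrow> c" "\<And>n. a n \<le> c * real n"
proof -
  define c where "c = (SUP n\<in>{1..}. a n / real n)"
  have "bdd_above ((\<lambda>n. a n / real n) ` {1..})"
    using bound by (intro bdd_aboveI[of _ K]) (auto simp: divide_le_eq)
  then have le_c: "a n / real n \<le> c" if "1 \<le> n" for n
    unfolding c_def using that by (intro cSUP_upper) auto
  have mult: "real q * a N \<le> a (q * N)" for q N
  proof (induction q)
    case (Suc q)
    then show ?case
      using super[of N "q * N"] by (simp add: algebra_simps)
  qed (simp add: nonneg)
  have "(\<lambda>n. a n / real n) \<longlonglongrightarrow> c"
  proof (rule order_tendstoI)
    fix y assume "y < c"
    then obtain N where N: "1 \<le> N" "y < a N / real N"
      unfolding c_def using less_cSUP_iff[OF _ \<open>bdd_above _\<close>, of y] by auto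
    have "(\<lambda>n. a N / real N - a N / real n) \<longlonglongrightarrow> a N / real N - 0"
      by (intro tendsto_diff tendsto_const lim_const_over_n)
    then have "eventually (\<lambda>n. y < a N / real N - a N / real n) sequentially"
      using N(2) by (intro order_tendstoD) auto
    then show "eventually (\<lambda>n. y < a n / real n) sequentially"
      using eventually_gt_at_top[of 0]
    proof eventually_elim
      case (elim n)
      have "real n = real (n div N) * real N + real (n mod N)"
        by (metis div_mult_mod_eq of_nat_add of_nat_mult)
      moreover have "real (n mod N) < real N"
        using N(1) by simp
      ultimately have "real n - real N \<le> real (n div N) * real N"
        by linarith
      then have "(real n - real N) / real N \<le> real (n div N)"
        using N(1) by (simp add: divide_le_eq)
      then have "(real n - real N) / real N * a N \<le> real (n div N) * a N"
        by (rule mult_right_mono[OF _ nonneg])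
      also have "\<dots> \<le> a (n div N * N)"
        by (rule mult)
      also have "\<dots> \<le> a n"
        using super[of "n div N * N" "n mod N"] nonneg[of "n mod N"] by simp
      finally have "(real n - real N) / real N * a N / real n \<le> a n / real n"
        by (rule divide_right_mono) simp
      moreover have "(real n - real N) / real N * a N / real n = a N / real N - a N / real n"
        using N(1) elim(2) by (simp add: field_simps)
      ultimately show ?case
        using elim(1) by linarith
    qed
  next
    fix y assume "c < y"
    show "eventually (\<lambda>n. a n / real n < y) sequentially"
      using eventually_ge_at_top[of 1]
    proof eventually_elim
      case (elim n)
      show ?case
        using le_c[OF elim] \<open>c < y\<close> by (rule le_less_trans)
    qed
  qed
  moreover have "a n \<le> c * real n" for n
  proof (cases "n = 0")
    \<comment> \<open>The supremum ranges over positive \<open>n\<close> only; at 0 the linear bound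
      gives \<open>a 0 \<le> 0\<close>.\<close>
    case True
    then show ?thesis
      using bound[of n] by simp
  next
    case False
    then show ?thesis
      using le_c[of n] by (simp add: divide_le_eq)
  qed
  ultimately show ?thesis
    by (rule that)
qed

text \<open>By Fekete's lemma the limit exists, so \<open>lim\<close> really denotes it, and it
  bounds the quotient for every \<open>n\<close>. A single one avoids a word of length at least 2,
  whence \<open>1 \<le> ex \<pi> 1\<close>; this keeps the logarithm base
  \<open>5 * fh_limit \<pi>\<close> above 1.\<close>

lemma fh_limit_bounds:
  assumes pi: "distinct \<pi>" "set \<pi> = {1..length \<pi>}" "2 \<le> length \<pi>"
  shows ex_le_fh_limit: "real (ex \<pi> n) \<le> fh_limit \<pi> * real n"
    and fh_limit_ge_1: "1 \<le> fh_limit \<pi>"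
proof -
  obtain K where K: "\<And>n. ex \<pi> n \<le> K * n"
    using marcus_tardos[OF pi] by blast
  obtain c where c: "(\<lambda>n. real (ex \<pi> n) / real n) \<longlonglongrightarrow> c" "\<And>n. real (ex \<pi> n) \<le> c * real n"
  proof (rule fekete[of "\<lambda>n. real (ex \<pi> n)" "real K"])
    show "real (ex \<pi> m) + real (ex \<pi> n) \<le> real (ex \<pi> (m + n))" for m n
      using ex_superadditive[OF pi, of m n] by linarith
    show "real (ex \<pi> n) \<le> real K * real n" for n
      using K[of n] by (metis of_nat_le_iff of_nat_mult)
  qed (auto)
  have lim: "fh_limit \<pi> = c"
    unfolding fh_limit_def using c(1) by (rule limI)
  show "real (ex \<pi> n) \<le> fh_limit \<pi> * real n"
    using c(2) lim by simp
  have "\<not> pattern_in \<pi> {(0::nat, 0::nat)}"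
  proof
    assume "pattern_in \<pi> {(0::nat, 0::nat)}"
    then obtain r c :: "nat \<Rightarrow> nat" where "\<And>i. i < length \<pi> \<Longrightarrow> (r i, c i) \<in> {(0, 0)}"
      "\<And>i j. i < j \<Longrightarrow> j < length \<pi> \<Longrightarrow> c i < c j"
      by (rule pattern_inE) blast
    from this(1)[of 0] this(1)[of 1] this(2)[of 0 1] show False
      using pi(3) by simp
  qed
  then have "card {(0::nat, 0::nat)} \<le> ex \<pi> 1"
    by (intro card_le_ex[OF pi(1,2)]) auto
  then show "1 \<le> fh_limit \<pi>"
    using c(2)[of 1] lim by simp
qed

section \<open>Serving requests recursively\<close>

text \<open>The servers \<open>J\<close> start in \<open>p\<close>, serve \<open>xs\<close> without leaving \<open>I\<close> and travel at most \<open>B\<close> in total.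
  The starting positions themselves need not lie in \<open>I\<close>.\<close>

fun servable :: "'j set \<Rightarrow> real set \<Rightarrow> ('j \<Rightarrow> real) \<Rightarrow> real list \<Rightarrow> real \<Rightarrow> bool" where
  "servable J I p [] B \<longleftrightarrow> 0 \<le> B"
| "servable J I p (x # xs) B \<longleftrightarrow> (\<exists>q. (\<exists>j\<in>J. q j = x) \<and> (\<forall>j\<in>J. q j \<in> I) \<and>
     servable J I q xs (B - (\<Sum>j\<in>J. \<bar>q j - p j\<bar>)))"

lemma servable_mono:
  "servable J I p xs B \<Longrightarrow> I \<subseteq> I' \<Longrightarrow> B \<le> B' \<Longrightarrow> servable J I' p xs B'"
proof (induction xs arbitrary: p B B')
  case (Cons x xs)
  then obtain q where q: "\<exists>j\<in>J. q j = x" "\<forall>j\<in>J. q j \<in> I"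
    "servable J I q xs (B - (\<Sum>j\<in>J. \<bar>q j - p j\<bar>))"
    by auto
  have "servable J I' q xs (B' - (\<Sum>j\<in>J. \<bar>q j - p j\<bar>))"
    using Cons.IH[OF q(3)] Cons.prems(2,3) by simp
  then show ?case
    using q(1,2) Cons.prems(2) by (auto intro!: exI[of _ q])
qed simp

lemma servable_cong:
  assumes "\<And>j. j \<in> J \<Longrightarrow> p j = p' j"
  shows "servable J I p xs B \<longleftrightarrow> servable J I p' xs B"
proof (cases xs)
  case (Cons x ys)
  have "(\<Sum>j\<in>J. \<bar>q j - p j\<bar>) = (\<Sum>j\<in>J. \<bar>q j - p' j\<bar>)" for q
    using assms by (intro sum.cong) auto
  then show ?thesis
    using Cons by simp
qed simp

text \<open>By the triangle inequality the first move absorbs a change of starting positions. A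
  group of servers can thus be analysed as if it started inside its row.\<close>

lemma servable_relocate:
  assumes "servable J I p' xs B"
  shows "servable J I p xs (B + (\<Sum>j\<in>J. \<bar>p' j - p j\<bar>))"
proof (cases xs)
  case Nil
  then show ?thesis
    using assms sum_nonneg[of J "\<lambda>j. \<bar>p' j - p j\<bar>"] by simp
next
  case (Cons x ys)
  with assms obtain q where q: "\<exists>j\<in>J. q j = x" "\<forall>j\<in>J. q j \<in> I"
    "servable J I q ys (B - (\<Sum>j\<in>J. \<bar>q j - p' j\<bar>))"
    by auto
  have "(\<Sum>j\<in>J. \<bar>q j - p j\<bar>) \<le> (\<Sum>j\<in>J. \<bar>q j - p' j\<bar> + \<bar>p' j - p j\<bar>)"
    by (rule sum_mono) linarith
  then have "servable J I q ys (B + (\<Sum>j\<in>J. \<bar>p' j - p j\<bar>) - (\<Sum>j\<in>J. \<bar>q j - p j\<bar>))"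
    by (intro servable_mono[OF q(3)]) (auto simp: sum.distrib)
  then show ?thesis
    using Cons q(1,2) by auto
qed

text \<open>The second list must be servable from every configuration in \<open>I\<close>, since the
  configuration reached after the first one is not recorded.\<close>

lemma servable_append:
  assumes "servable J I p xs A" "\<And>j. j \<in> J \<Longrightarrow> p j \<in> I"
    and "\<And>p'. (\<And>j. j \<in> J \<Longrightarrow> p' j \<in> I) \<Longrightarrow> servable J I p' ys B"
  shows "servable J I p (xs @ ys) (A + B)"
  using assms(1,2)
proof (induction xs arbitrary: p A)
  case Nil
  then show ?case
    using servable_mono[OF assms(3), of p I "A + B"] by simp
next
  case (Cons x xs)
  then obtain q where q: "\<exists>j\<in>J. q j = x" "\<forall>j\<in>J. q j \<in> I"
    "servable J I q xs (A - (\<Sum>j\<in>J. \<bar>q j - p j\<bar>))"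
    by auto
  have "servable J I q (xs @ ys) (A - (\<Sum>j\<in>J. \<bar>q j - p j\<bar>) + B)"
    using Cons.IH[OF q(3)] q(2) by blast
  then show ?case
    using q(1,2) by (auto simp: algebra_simps intro!: exI[of _ q])
qed

text \<open>Request \<open>x\<close> is left to the group \<open>G (f x)\<close> while all other
  servers stand still. As the groups are disjoint, their costs add up although their requests are
  interleaved.\<close>

lemma servable_merge:
  assumes "finite J" and J: "\<And>r. r \<in> R \<Longrightarrow> G r \<subseteq> J"
    and disj: "\<And>r r'. r \<in> R \<Longrightarrow> r' \<in> R \<Longrightarrow> r \<noteq> r' \<Longrightarrow> G r \<inter> G r' = {}"
    and R: "finite R" "\<And>x. x \<in> set xs \<Longrightarrow> f x \<in> R"
    and p: "\<And>j. j \<in> J \<Longrightarrow> p j \<in> I"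
    and serv: "\<And>r. r \<in> R \<Longrightarrow> servable (G r) I p (filter (\<lambda>x. f x = r) xs) (B r)"
  shows "servable J I p xs (\<Sum>r\<in>R. B r)"
  using R(2) p serv
proof (induction xs arbitrary: p B)
  case Nil
  then show ?case
    by (simp add: sum_nonneg)
next
  case (Cons x xs)
  let ?G = "G (f x)"
  have fx: "f x \<in> R"
    using Cons.prems(1) by simp
  from Cons.prems(3)[OF fx] obtain q where q: "\<exists>j\<in>?G. q j = x" "\<forall>j\<in>?G. q j \<in> I"
    "servable ?G I q (filter (\<lambda>y. f y = f x) xs) (B (f x) - (\<Sum>j\<in>?G. \<bar>q j - p j\<bar>))"
    by auto
  define p' where "p' = (\<lambda>j. if j \<in> ?G then q j else p j)"
  define D where "D = (\<Sum>j\<in>?G. \<bar>q j - p j\<bar>)"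
  have move: "(\<Sum>j\<in>J. \<bar>p' j - p j\<bar>) = D"
    unfolding D_def using J[OF fx] \<open>finite J\<close>
    by (intro sum.mono_neutral_cong_right) (auto simp: p'_def)
  \<comment> \<open>Only the group in charge of \<open>x\<close> spends budget, namely
    \<open>D\<close>.\<close>
  have "servable J I p' xs (\<Sum>r\<in>R. B r - (if r = f x then D else 0))"
  proof (rule Cons.IH)
    show "f y \<in> R" if "y \<in> set xs" for y
      using Cons.prems(1) that by simp
    show "p' j \<in> I" if "j \<in> J" for j
      using q(2) Cons.prems(2) that by (simp add: p'_def)
    fix r assume r: "r \<in> R"
    show "servable (G r) I p' (filter (\<lambda>y. f y = r) xs) (B r - (if r = f x then D else 0))"
    proof (cases "r = f x")
      case True
      then show ?thesis
        using q(3) servable_cong[of ?G p' q] by (simp add: p'_def D_def)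
    next
      case False
      then have "servable (G r) I p (filter (\<lambda>y. f y = r) xs) (B r)"
        using Cons.prems(3)[OF r] by simp
      moreover have "p' j = p j" if "j \<in> G r" for j
        using disj[OF r fx False] that by (auto simp: p'_def)
      ultimately show ?thesis
        using False servable_cong[of "G r" p' p] by simp
    qed
  qed
  moreover have "(\<Sum>r\<in>R. B r - (if r = f x then D else 0)) = (\<Sum>r\<in>R. B r) - D"
    using R(1) fx by (simp add: sum_subtractf)
  moreover have "\<exists>j\<in>J. p' j = x" "\<forall>j\<in>J. p' j \<in> I"
    using q(1,2) J[OF fx] Cons.prems(2) by (auto simp: p'_def)
  ultimately show ?case
    using move by (auto intro!: exI[of _ p'])
qed

text \<open>Merging with a single class: the additional servers never move, so they have to start in
  \<open>I\<close>.\<close>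

lemma servable_superset:
  assumes "servable J I p xs B" "J \<subseteq> J'" "finite J'" "\<And>j. j \<in> J' \<Longrightarrow> p j \<in> I"
  shows "servable J' I p xs B"
  using servable_merge[of J' "{()}" "\<lambda>_. J" xs "\<lambda>_. ()" p I "\<lambda>_. B"] assms by simp

text \<open>Base case of the recursion: two points of the interval are at distance at most
  \<open>h\<close>.\<close>

lemma servable_single:
  assumes "set xs \<subseteq> {a..a + h}" "p j \<in> {a..a + h}"
  shows "servable {j} {a..a + h} p xs (h * real (length xs))"
  using assms
proof (induction xs arbitrary: p)
  case (Cons x xs)
  have "servable {j} {a..a + h} (\<lambda>_. x) xs (h * real (length xs))"
    using Cons by simp
  moreover have "h * real (length xs) \<le> h * real (length (x # xs)) - \<bar>x - p j\<bar>"
    using Cons.prems by (auto simp: algebra_simps abs_le_iff)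
  ultimately have "servable {j} {a..a + h} (\<lambda>_. x) xs (h * real (length (x # xs)) - \<bar>x - p j\<bar>)"
    by (rule servable_mono[OF _ order_refl])
  then show ?case
    using Cons.prems(1) by (auto intro!: exI[of _ "\<lambda>_. x"])
qed simp

section \<open>Time slabs and pattern avoidance\<close>

text \<open>Elements taken from lists with increasing indices occur in that order in the
  concatenation. The bound \<open>d\<close> lets the induction hypothesis be applied to the lists
  before the one that holds the last element.\<close>

lemma subseq_concat_choice:
  assumes "\<And>i j. i < j \<Longrightarrow> j < m \<Longrightarrow> c i < c j"
    and "\<And>i. i < m \<Longrightarrow> c i < length yss \<and> x i \<in> set (yss ! c i)"
    and "\<And>i. i < m \<Longrightarrow> c i < d"
  shows "subseq (map x [0..<m]) (concat (take d yss))"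
  using assms
proof (induction m arbitrary: d)
  case (Suc m)
  let ?c = "c m"
  have c: "?c < length yss" "x m \<in> set (yss ! ?c)" "?c < d"
    using Suc.prems by simp_all
  have "subseq (map x [0..<m]) (concat (take ?c yss))"
    using Suc.prems by (intro Suc.IH) auto
  moreover have "subseq [x m] (yss ! ?c)"
    using c(2) by (simp add: subseq_singleton_left)
  ultimately have main: "subseq (map x [0..<m] @ [x m]) (concat (take ?c yss) @ yss ! ?c)"
    by (rule list_emb_append_mono)
  have "take d yss = take (Suc ?c) yss @ drop (Suc ?c) (take d yss)"
    using c(3) by (metis Suc_leI append_take_drop_id min.absorb1 take_take)
  then have "concat (take d yss) = (concat (take ?c yss) @ yss ! ?c) @ concat (drop (Suc ?c) (take d yss))"
    using c(1) by (metis concat_append concat.simps(1,2) append_Nil2 take_Suc_conv_app_nth)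
  with list_emb_append_mono[OF main, of "[]" "concat (drop (Suc ?c) (take d yss))"]
  show ?case
    by simp
qed simp

lemma seq_avoids_subseq: "seq_avoids xs \<pi> \<Longrightarrow> subseq ys xs \<Longrightarrow> seq_avoids ys \<pi>"
  unfolding seq_avoids_def seq_contains_def using subseq_order.order_trans by blast

text \<open>One request is chosen from each cell of the occurrence. Later slabs give later requests,
  and since \<open>f\<close> is monotone on the requests, a smaller row forces a smaller
  value.\<close>

lemma seq_contains_slabs:
  fixes yss :: "'a::linorder list list" and f :: "'a \<Rightarrow> 'b::linorder"
  assumes pi: "distinct \<pi>"
    and f: "\<And>x y. x \<in> set (concat yss) \<Longrightarrow> y \<in> set (concat yss) \<Longrightarrow> x \<le> y \<Longrightarrow> f x \<le> f y"
    and pat: "pattern_in \<pi> {(f x, b) | x b. b < length yss \<and> x \<in> set (yss ! b)}"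
  shows "seq_contains (concat yss) \<pi>"
proof -
  let ?m = "length \<pi>"
  obtain r c where rc: "\<And>i. i < ?m \<Longrightarrow> (r i, c i) \<in> {(f x, b) | x b. b < length yss \<and> x \<in> set (yss ! b)}"
    "\<And>i j. i < j \<Longrightarrow> j < ?m \<Longrightarrow> c i < c j"
    "\<And>i j. i < ?m \<Longrightarrow> j < ?m \<Longrightarrow> \<pi> ! i < \<pi> ! j \<Longrightarrow> r i < r j"
    using pat by (rule pattern_inE) blast
  then have "\<forall>i. \<exists>x. i < ?m \<longrightarrow> c i < length yss \<and> x \<in> set (yss ! c i) \<and> r i = f x"
    by blast
  then obtain x where x: "\<And>i. i < ?m \<Longrightarrow> c i < length yss \<and> x i \<in> set (yss ! c i) \<and> r i = f (x i)"
    by metis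
  have "subseq (map x [0..<?m]) (concat (take (length yss) yss))"
    using rc(2) x by (intro subseq_concat_choice[where c = c]) auto
  then have "subseq (map x [0..<?m]) (concat yss)"
    by simp
  moreover have lt: "x i < x j" if "i < ?m" "j < ?m" "\<pi> ! i < \<pi> ! j" for i j
  proof (rule ccontr)
    assume "\<not> x i < x j"
    then have "f (x j) \<le> f (x i)"
      using x[OF that(1)] x[OF that(2)] by (intro f) (auto intro: nth_mem)
    then show False
      using rc(3)[OF that] x[OF that(1)] x[OF that(2)] by simp
  qed
  have "x i < x j \<longleftrightarrow> \<pi> ! i < \<pi> ! j" if "i < ?m" "j < ?m" for i j
    using lt[OF that] lt[OF that(2,1)] nth_eq_iff_index_eq[OF pi that]
    by (metis less_asym less_irrefl linorder_neqE)
  then have "order_isomorphic (map x [0..<?m]) \<pi>"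
    by (simp add: order_isomorphic_def)
  ultimately show ?thesis
    unfolding seq_contains_def by blast
qed

text \<open>One more element raises the number of values of \<open>f\<close> by at most 1, so the
  shortest prefix with at least \<open>q\<close> values has exactly \<open>q\<close>. It is nonempty
  because \<open>0 < q\<close>, so cutting it off and repeating terminates.\<close>

lemma slab_decomposition:
  assumes "0 < q"
  obtains yss zs where "xs = concat yss @ zs" "\<And>ys. ys \<in> set yss \<Longrightarrow> card (f ` set ys) = q"
    "card (f ` set zs) \<le> q"
proof -
  have "\<exists>yss zs. xs = concat yss @ zs \<and> (\<forall>ys\<in>set yss. card (f ` set ys) = q) \<and> card (f ` set zs) \<le> q"
  proof (induction xs rule: length_induct)
    case (1 xs)
    show ?case
    proof (cases "card (f ` set xs) \<le> q")
      case True
      then show ?thesis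
        by (intro exI[of _ "[]"] exI[of _ xs]) simp
    next
      case False
      let ?g = "\<lambda>i. card (f ` set (take i xs))"
      have step: "?g (Suc i) \<le> Suc (?g i)" for i
      proof (cases "i < length xs")
        case True
        then show ?thesis
          by (simp add: take_Suc_conv_app_nth card_insert_if)
      qed simp
      have "\<exists>i\<le>length xs. ?g i = q"
      proof -
        let ?i = "LEAST i. q \<le> ?g i"
        have ex: "q \<le> ?g (length xs)"
          using False by simp
        then have "q \<le> ?g ?i" "?i \<le> length xs"
          by (rule LeastI, rule Least_le)
        moreover have "?g ?i \<le> q"
        proof (cases ?i)
          case (Suc i)
          then have "\<not> q \<le> ?g i"
            using not_less_Least[of i "\<lambda>i. q \<le> ?g i"] by simp
          then show ?thesis
            using step[of i] Suc by simp
        qed simp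
        ultimately show ?thesis
          by (intro exI[of _ ?i]) simp
      qed
      then obtain i where i: "?g i = q"
        by blast
      then have "0 < i"
        using assms by (cases i) auto
      moreover have "xs \<noteq> []"
        using False by auto
      ultimately have "length (drop i xs) < length xs"
        by simp
      then obtain yss zs where "drop i xs = concat yss @ zs" "\<forall>ys\<in>set yss. card (f ` set ys) = q"
        "card (f ` set zs) \<le> q"
        using 1 by blast
      then show ?thesis
        using i append_take_drop_id[of i xs]
        by (intro exI[of _ "take i xs # yss"] exI[of _ zs]) auto
    qed
  qed
  then show ?thesis
    using that by blast
qed

lemma disjoint_groups:
  assumes "finite J" "card J = q * K"
  obtains G :: "nat \<Rightarrow> 'j set" where "\<And>b. b < q \<Longrightarrow> G b \<subseteq> J \<and> card (G b) = K"
    "\<And>b b'. b < q \<Longrightarrow> b' < q \<Longrightarrow> b \<noteq> b' \<Longrightarrow> G b \<inter> G b' = {}"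
proof -
  have "\<exists>G. (\<forall>b<q. G b \<subseteq> J \<and> card (G b) = K) \<and>
    (\<forall>b<q. \<forall>b'<q. b \<noteq> b' \<longrightarrow> G b \<inter> G b' = {})"
    using assms
  proof (induction q arbitrary: J)
    case (Suc q)
    then have "K \<le> card J"
      by simp
    then obtain A where A: "A \<subseteq> J" "card A = K"
      by (rule obtain_subset_with_card_n)
    then have "card (J - A) = q * K"
      using Suc.prems by (simp add: card_Diff_subset finite_subset)
    then obtain G where G: "\<forall>b<q. G b \<subseteq> J - A \<and> card (G b) = K"
      "\<forall>b<q. \<forall>b'<q. b \<noteq> b' \<longrightarrow> G b \<inter> G b' = {}"
      using Suc.IH[of "J - A"] Suc.prems(1) by blast
    have "\<forall>b<Suc q. (G(q := A)) b \<subseteq> J \<and> card ((G(q := A)) b) = K"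
      using A G(1) by (auto simp: less_Suc_eq)
    moreover have "(G(q := A)) b \<inter> (G(q := A)) b' = {}" if "b < Suc q" "b' < Suc q" "b \<noteq> b'" for b b'
    proof -
      have "G c \<inter> A = {}" if "c < q" for c
        using G(1) that by blast
      then show ?thesis
        using G(2) that by (simp add: less_Suc_eq Int_commute)  blast
    qed
    ultimately show ?case
      by blast
  qed simp
  then show ?thesis
    using that by blast
qed

lemma sum_length_filter_classes:
  assumes "finite R" "f ` set xs \<subseteq> R"
  shows "(\<Sum>r\<in>R. length (filter (\<lambda>x. f x = r) xs)) = length xs"
  using assms(2)
proof (induction xs)
  case (Cons x xs)
  have "(\<Sum>r\<in>R. length (filter (\<lambda>y. f y = r) (x # xs))) =
      (\<Sum>r\<in>R. length (filter (\<lambda>y. f y = r) xs) + (if r = f x then 1 else 0))"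
    by (intro sum.cong) auto
  then show ?case
    using Cons assms(1) by (simp add: sum.distrib)
qed simp

text \<open>\<open>\<alpha>\<close> is the price per request and \<open>\<beta>\<close> the overhead
  per list; bounds of this affine form add up.\<close>

lemma servable_concat:
  assumes "\<And>ys p. ys \<in> set yss \<Longrightarrow> (\<And>j. j \<in> J \<Longrightarrow> p j \<in> I) \<Longrightarrow> servable J I p ys (\<alpha> * real (length ys) + \<beta>)"
    and "\<And>j. j \<in> J \<Longrightarrow> p j \<in> I"
  shows "servable J I p (concat yss) (\<alpha> * real (length (concat yss)) + \<beta> * real (length yss))"
  using assms
proof (induction yss arbitrary: p)
  case (Cons ys yss)
  have "servable J I p (ys @ concat yss)
      ((\<alpha> * real (length ys) + \<beta>) + (\<alpha> * real (length (concat yss)) + \<beta> * real (length yss)))"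
    using Cons by (intro servable_append) auto
  then show ?case
    by (simp add: algebra_simps)
qed simp

text \<open>Rows are closed above, so that the right end \<open>a + s \<delta>\<close> of an interval cut into \<open>s\<close> rows
  still belongs to one of the rows below \<open>s\<close>.\<close>

definition row :: "real \<Rightarrow> real \<Rightarrow> real \<Rightarrow> nat" where
  "row a \<delta> x = (LEAST i. x \<le> a + real (Suc i) * \<delta>)"

lemma row_bounds:
  assumes "0 < s" "a \<le> x" "x \<le> a + real s * \<delta>"
  shows row_less: "row a \<delta> x < s"
    and row_lower: "a + real (row a \<delta> x) * \<delta> \<le> x"
    and row_upper: "x \<le> a + real (row a \<delta> x) * \<delta> + \<delta>"
proof -
  have ex: "x \<le> a + real (Suc (s - 1)) * \<delta>"
    using assms by simp
  then have "row a \<delta> x \<le> s - 1"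
    unfolding row_def by (rule Least_le)
  then show "row a \<delta> x < s"
    using assms(1) by linarith
  show "x \<le> a + real (row a \<delta> x) * \<delta> + \<delta>"
    using LeastI[of "\<lambda>i. x \<le> a + real (Suc i) * \<delta>", OF ex]
    by (simp add: row_def algebra_simps)
  show "a + real (row a \<delta> x) * \<delta> \<le> x"
  proof (cases "row a \<delta> x")
    case 0
    then show ?thesis
      using assms(2) by simp
  next
    case (Suc i)
    then show ?thesis
      using not_less_Least[of i "\<lambda>i. x \<le> a + real (Suc i) * \<delta>"] by (simp add: row_def)
  qed
qed

lemma row_mono:
  assumes "0 < s" "x \<le> y" "y \<le> a + real s * \<delta>"
  shows "row a \<delta> x \<le> row a \<delta> y"
proof -
  have "y \<le> a + real (Suc (s - 1)) * \<delta>"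
    using assms by simp
  then have "y \<le> a + real (Suc (row a \<delta> y)) * \<delta>"
    unfolding row_def by (rule LeastI)
  then have "x \<le> a + real (Suc (row a \<delta> y)) * \<delta>"
    using assms(2) by linarith
  then show ?thesis
    unfolding row_def[of a \<delta> x] by (rule Least_le)
qed

section \<open>Number of slabs and the recursive strategy\<close>

text \<open>With \<open>t > s\<close> slabs, the cells (row, slab) would fit into a
  \<open>t \<times> t\<close> square, avoid \<open>\<pi>\<close> because the requests do, and number
  exactly \<open>q * t\<close>, which exceeds \<open>ex \<pi> t\<close>.\<close>

lemma slab_count:
  assumes pi: "distinct \<pi>" "set \<pi> = {1..length \<pi>}"
    and ex_less: "\<And>t. 0 < t \<Longrightarrow> ex \<pi> t < q * t"
    and f: "\<And>x y. x \<in> set (concat yss) \<Longrightarrow> y \<in> set (concat yss) \<Longrightarrow> x \<le> y \<Longrightarrow> f x \<le> f y"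
    and f_less: "\<And>x. x \<in> set (concat yss) \<Longrightarrow> f x < s"
    and avoids: "seq_avoids (concat yss) \<pi>"
    and card: "\<And>ys. ys \<in> set yss \<Longrightarrow> card (f ` set ys) = q"
  shows "length yss \<le> s"
proof (rule ccontr)
  let ?t = "length yss"
  let ?S = "{(f x, b) | x b. b < ?t \<and> x \<in> set (yss ! b)}"
  assume "\<not> ?t \<le> s"
  then have t: "s < ?t"
    by simp
  have mem: "x \<in> set (concat yss)" if "b < ?t" "x \<in> set (yss ! b)" for x b
    using that by auto
  have "?S \<subseteq> {..<?t} \<times> {..<?t}"
    using mem f_less t by (force intro: less_trans)
  moreover have "\<not> pattern_in \<pi> ?S"
  proof
    assume "pattern_in \<pi> ?S"
    then have "seq_contains (concat yss) \<pi>"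
      by (rule seq_contains_slabs[OF pi(1), rotated]) (rule f)
    then show False
      using avoids unfolding seq_avoids_def by blast
  qed
  ultimately have "card ?S \<le> ex \<pi> ?t"
    by (rule card_le_ex[OF pi])
  moreover have "?S = (\<lambda>(b, v). (v, b)) ` (SIGMA b:{..<?t}. f ` set (yss ! b))"
    by force
  then have "card ?S = card (SIGMA b:{..<?t}. f ` set (yss ! b))"
    by (simp add: card_image inj_on_def)
  then have "card ?S = ?t * q"
    using card by (simp add: card_SigmaI)
  moreover have "0 < ?t"
    using t by linarith
  then have "ex \<pi> ?t < q * ?t"
    by (rule ex_less)
  ultimately show False
    by (simp add: mult.commute)
qed

text \<open>Induction on \<open>L\<close>. In a slab, each of at most \<open>q\<close> groups first
  travels to its row, for at most \<open>q ^ L * h\<close>, and then pays the bound for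
  \<open>L\<close> at height \<open>h / s\<close>. There the price per request drops by a factor
  \<open>s\<close>, and the fixed term becomes \<open>h * (4 * q) ^ L\<close>. Over at most
  \<open>2 * s\<close> slabs the fixed costs stay below the second summand for
  \<open>Suc L\<close>.\<close>

lemma servable_level:
  fixes q s :: nat and J :: "'j set"
  assumes pi: "distinct \<pi>" "set \<pi> = {1..length \<pi>}"
    and ex_less: "\<And>t. 0 < t \<Longrightarrow> ex \<pi> t < q * t"
    and q: "0 < q" and s: "0 < s"
    and "finite J" "card J = q ^ L" "0 < h" "set xs \<subseteq> {a..a + h}" "seq_avoids xs \<pi>"
    and "\<And>j. j \<in> J \<Longrightarrow> p j \<in> {a..a + h}"
  shows "servable J {a..a + h} p xs (h * (real (length xs) / real s ^ L + (4 * real q) ^ L * real s))"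
  using assms(6-)
proof (induction L arbitrary: J a h xs p)
  case 0
  then obtain j where "J = {j}"
    by (auto simp: card_Suc_eq)
  then have "servable J {a..a + h} p xs (h * real (length xs))"
    using 0 servable_single by simp
  then show ?case
    by (rule servable_mono) (use 0 in \<open>simp_all add: algebra_simps\<close>)
next
  case (Suc L)
  let ?I = "{a..a + h}"
  define \<delta> where "\<delta> = h / real s"
  define E where "E = (4 * real q) ^ L"
  \<comment> \<open>Price per request and overhead per slab: \<open>q\<close> groups, each paying
    \<open>h * E\<close> within the recursion and \<open>q ^ L * h\<close> for moving in.\<close>
  define \<alpha> where "\<alpha> = h / real s ^ Suc L"
  define \<beta> where "\<beta> = real q * (h * E + real (q ^ L) * h)"
  let ?f = "row a \<delta>"
  have \<delta>: "0 < \<delta>" "real s * \<delta> = h"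
    using Suc.prems(3) s by (simp_all add: \<delta>_def)
  have row: "?f x < s" "a + real (?f x) * \<delta> \<le> x" "x \<le> a + real (?f x) * \<delta> + \<delta>" if "x \<in> ?I" for x
    using row_bounds[OF s, of a x \<delta>] that \<delta>(2) by auto
  obtain G where G: "\<And>b. b < q \<Longrightarrow> G b \<subseteq> J \<and> card (G b) = q ^ L"
    "\<And>b b'. b < q \<Longrightarrow> b' < q \<Longrightarrow> b \<noteq> b' \<Longrightarrow> G b \<inter> G b' = {}"
    using disjoint_groups[of J q "q ^ L"] Suc.prems(1,2) by auto
  have slab: "servable J ?I p ys (\<alpha> * real (length ys) + \<beta>)"
    if ys: "set ys \<subseteq> ?I" "seq_avoids ys \<pi>" "card (?f ` set ys) \<le> q"
      and p: "\<And>j. j \<in> J \<Longrightarrow> p j \<in> ?I" for ys p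
  proof -
    let ?R = "?f ` set ys"
    let ?ys = "\<lambda>r. filter (\<lambda>x. ?f x = r) ys"
    \<comment> \<open>A slab meets at most \<open>q\<close> rows, so every row gets a group of its
      own.\<close>
    obtain g where g: "inj_on g ?R" "g ` ?R \<subseteq> {..<q}"
      using inj_on_iff_card_le[of ?R "{..<q}"] ys(3) by auto
    let ?B = "\<lambda>r. \<delta> * (real (length (?ys r)) / real s ^ L + E * real s) + real (q ^ L) * h"
    have "servable J ?I p ys (\<Sum>r\<in>?R. ?B r)"
    proof (rule servable_merge[where f = ?f and G = "\<lambda>r. G (g r)"])
      fix r assume r: "r \<in> ?R"
      let ?a = "a + real r * \<delta>"
      have gr: "g r < q"
        using g(2) r by blast
      have "r < s"
        using r row(1) ys(1) by blast
      then have "(real r + 1) * \<delta> \<le> real s * \<delta>"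
        using \<delta>(1) by (intro mult_right_mono) auto
      then have sub: "{?a..?a + \<delta>} \<subseteq> ?I"
        using \<delta> by (auto simp: algebra_simps)
      have fin: "finite (G (g r))"
        using G(1)[OF gr] Suc.prems(1) finite_subset by blast
      \<comment> \<open>The recursion is applied to the group gathered at the lower end of its row;
        bringing it there is paid for separately.\<close>
      have "servable (G (g r)) {?a..?a + \<delta>} (\<lambda>_. ?a) (?ys r)
          (\<delta> * (real (length (?ys r)) / real s ^ L + E * real s))"
        unfolding E_def
      proof (rule Suc.IH)
        show "set (?ys r) \<subseteq> {?a..?a + \<delta>}"
          using row(2,3) ys(1) by auto
        show "seq_avoids (?ys r) \<pi>"
          using ys(2) by (rule seq_avoids_subseq) (rule subseq_filter_left)
      qed (use fin G(1)[OF gr] \<delta>(1) in auto)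
      then have "servable (G (g r)) ?I (\<lambda>_. ?a) (?ys r)
          (\<delta> * (real (length (?ys r)) / real s ^ L + E * real s))"
        using sub by (rule servable_mono) simp
      then have serv: "servable (G (g r)) ?I p (?ys r)
          (\<delta> * (real (length (?ys r)) / real s ^ L + E * real s) + (\<Sum>j\<in>G (g r). \<bar>?a - p j\<bar>))"
        by (rule servable_relocate)
      have "?a \<in> ?I"
        using sub \<delta>(1) by auto
      then have "\<bar>?a - p j\<bar> \<le> h" if "j \<in> G (g r)" for j
        using p[of j] G(1)[OF gr] that by (auto simp: abs_le_iff)
      then have "(\<Sum>j\<in>G (g r). \<bar>?a - p j\<bar>) \<le> real (card (G (g r))) * h"
        by (rule sum_bounded_above)
      then show "servable (G (g r)) ?I p (?ys r) (?B r)"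
        using serv G(1)[OF gr] by (intro servable_mono[OF serv]) auto
      show "G (g r) \<subseteq> J"
        using G(1)[OF gr] by simp
    next
      fix r r' assume "r \<in> ?R" "r' \<in> ?R" "r \<noteq> r'"
      then have "g r < q" "g r' < q" "g r \<noteq> g r'"
        using g by (auto dest: inj_onD)
      then show "G (g r) \<inter> G (g r') = {}"
        by (rule G(2))
    qed (use Suc.prems(1) p in auto)
    moreover have "(\<Sum>r\<in>?R. ?B r) \<le> \<alpha> * real (length ys) + \<beta>"
    proof -
      have "(\<Sum>r\<in>?R. ?B r) = (\<Sum>r\<in>?R. \<alpha> * real (length (?ys r)) + (h * E + real (q ^ L) * h))"
        using s by (intro sum.cong) (auto simp: \<delta>_def \<alpha>_def field_simps)
      also have "\<dots> = \<alpha> * real (\<Sum>r\<in>?R. length (?ys r)) + real (card ?R) * (h * E + real (q ^ L) * h)"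
        by (simp add: sum.distrib sum_distrib_left)
      also have "(\<Sum>r\<in>?R. length (?ys r)) = length ys"
        by (rule sum_length_filter_classes) auto
      also have "real (card ?R) * (h * E + real (q ^ L) * h) \<le> \<beta>"
        unfolding \<beta>_def using ys(3) Suc.prems(3) by (intro mult_right_mono) (auto simp: E_def)
      finally show ?thesis
        by simp
    qed
    ultimately show ?thesis
      by (rule servable_mono[OF _ order_refl])
  qed
  obtain yss zs where xs: "xs = concat yss @ zs" and yss: "\<And>ys. ys \<in> set yss \<Longrightarrow> card (?f ` set ys) = q"
    and zs: "card (?f ` set zs) \<le> q"
    using slab_decomposition[OF q, of xs ?f] by blast
  have sub_ys: "subseq ys xs" if ys: "ys \<in> set yss" for ys
  proof -
    obtain us vs where "yss = us @ ys # vs"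
      using split_list[OF ys] by blast
    then have "xs = concat us @ ys @ (concat vs @ zs)"
      using xs by simp
    then show ?thesis
      by (metis list_emb_append2 list_emb_append_mono append_Nil2 list_emb_Nil subseq_order.order_refl)
  qed
  have sub_zs: "subseq zs xs" and sub_concat: "subseq (concat yss) xs"
    using xs by (auto intro: list_emb_append2 subseq_rev_drop_many)
  have inI: "x \<in> ?I" if "x \<in> set (concat yss)" for x
    using Suc.prems(4) xs that by auto
  have "length yss \<le> s"
  proof (rule slab_count[OF pi ex_less, where f = ?f])
    show "?f x \<le> ?f y" if "x \<in> set (concat yss)" "y \<in> set (concat yss)" "x \<le> y" for x y
      using inI[OF that(2)] that(3) \<delta>(2) by (intro row_mono[OF s]) auto
    show "?f x < s" if "x \<in> set (concat yss)" for x
      using row(1) inI[OF that] .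
    show "seq_avoids (concat yss) \<pi>"
      using Suc.prems(5) sub_concat by (rule seq_avoids_subseq)
  qed (use yss in auto)
  \<comment> \<open>The last, possibly incomplete slab \<open>zs\<close> is counted as well:
    \<open>s + 1 \<le> 2 * s\<close>.\<close>
  then have count: "length (yss @ [zs]) \<le> 2 * s"
    using s by simp
  have "servable J ?I p (concat (yss @ [zs]))
      (\<alpha> * real (length (concat (yss @ [zs]))) + \<beta> * real (length (yss @ [zs])))"
  proof (rule servable_concat)
    fix ys p assume ys: "ys \<in> set (yss @ [zs])" and p: "\<And>j. j \<in> J \<Longrightarrow> p j \<in> ?I"
    have "subseq ys xs" "card (?f ` set ys) \<le> q"
      using ys sub_ys sub_zs yss zs by auto
    then show "servable J ?I p ys (\<alpha> * real (length ys) + \<beta>)"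
      using Suc.prems(4,5) p seq_avoids_subseq
      by (intro slab) (auto dest: list_emb_set)
  qed (use Suc.prems(6) in auto)
  then have "servable J ?I p xs (\<alpha> * real (length xs) + \<beta> * real (length (yss @ [zs])))"
    using xs by simp
  moreover have "\<beta> * real (length (yss @ [zs])) \<le> h * ((4 * real q) ^ Suc L * real s)"
  proof -
    \<comment> \<open>Moving in costs no more than the recursion, which gives a factor 2; together
      with the \<open>2 * s\<close> slabs this makes the 4 in \<open>4 * q\<close>.\<close>
    have "real q ^ L \<le> E"
      unfolding E_def by (intro power_mono) auto
    then have "\<beta> \<le> real q * (h * E + E * h)"
      unfolding \<beta>_def using Suc.prems(3) by (intro mult_left_mono add_mono mult_right_mono) auto
    moreover have "0 \<le> \<beta>" "0 \<le> E"
      using Suc.prems(3) by (auto simp: \<beta>_def E_def)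
    ultimately have "\<beta> * real (length (yss @ [zs])) \<le> (real q * (h * E + E * h)) * (2 * real s)"
      using count Suc.prems(3) by (intro mult_mono) (auto simp: of_nat_le_iff[symmetric] simp del: of_nat_le_iff)
    also have "\<dots> = h * ((4 * real q) ^ Suc L * real s)"
      by (simp add: E_def algebra_simps)
    finally show ?thesis .
  qed
  ultimately show ?case
    by (elim servable_mono) (auto simp: \<alpha>_def algebra_simps)
qed

section \<open>From servable sequences to \<open>OPT\<close>\<close>

text \<open>The configurations chosen one after another by the recursive predicate are collected
  into one function of time, the form that \<open>valid_solution\<close> expects; \<open>P i\<close>
  is the configuration after \<open>i\<close> requests.\<close>

lemma servable_schedule:
  assumes "servable J I p xs B"
  obtains P where "P 0 = p"
    "\<And>i. i < length xs \<Longrightarrow> (\<forall>j\<in>J. P (Suc i) j \<in> I) \<and> (\<exists>j\<in>J. P (Suc i) j = xs ! i)"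
    "(\<Sum>i<length xs. \<Sum>j\<in>J. \<bar>P (Suc i) j - P i j\<bar>) \<le> B"
proof -
  have "\<exists>P. P 0 = p \<and> (\<forall>i<length xs. (\<forall>j\<in>J. P (Suc i) j \<in> I) \<and> (\<exists>j\<in>J. P (Suc i) j = xs ! i)) \<and>
    (\<Sum>i<length xs. \<Sum>j\<in>J. \<bar>P (Suc i) j - P i j\<bar>) \<le> B"
    using assms
  proof (induction xs arbitrary: p B)
    case (Cons x xs)
    then obtain q where q: "\<exists>j\<in>J. q j = x" "\<forall>j\<in>J. q j \<in> I"
      "servable J I q xs (B - (\<Sum>j\<in>J. \<bar>q j - p j\<bar>))"
      by auto
    from Cons.IH[OF q(3)] obtain P where P: "P 0 = q"
      "\<forall>i<length xs. (\<forall>j\<in>J. P (Suc i) j \<in> I) \<and> (\<exists>j\<in>J. P (Suc i) j = xs ! i)"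
      "(\<Sum>i<length xs. \<Sum>j\<in>J. \<bar>P (Suc i) j - P i j\<bar>) \<le> B - (\<Sum>j\<in>J. \<bar>q j - p j\<bar>)"
      by blast
    show ?case
    proof (intro exI conjI allI impI)
      let ?P = "case_nat p P"
      show "?P 0 = p"
        by simp
      show "(\<Sum>i<length (x # xs). \<Sum>j\<in>J. \<bar>?P (Suc i) j - ?P i j\<bar>) \<le> B"
        using P(1,3) by (simp add: sum.lessThan_Suc_shift del: sum.lessThan_Suc)
      fix i assume "i < length (x # xs)"
      then show "\<forall>j\<in>J. ?P (Suc i) j \<in> I" "\<exists>j\<in>J. ?P (Suc i) j = (x # xs) ! i"
        using P(1,2) q(1,2) by (cases i; simp)+
    qed
  qed (auto intro: exI[of _ "\<lambda>_. p"])
  then show ?thesis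
    using that by blast
qed

lemma OPT_le_servable:
  assumes "servable {1..k} {0..1} (\<lambda>_. 0) X B"
  shows "OPT k X \<le> B"
proof -
  obtain P where P: "P 0 = (\<lambda>_. 0)"
    "\<And>i. i < length X \<Longrightarrow> (\<forall>j\<in>{1..k}. P (Suc i) j \<in> {0..1}) \<and> (\<exists>j\<in>{1..k}. P (Suc i) j = X ! i)"
    "(\<Sum>i<length X. \<Sum>j\<in>{1..k}. \<bar>P (Suc i) j - P i j\<bar>) \<le> B"
    using servable_schedule[OF assms] by blast
  have "(\<forall>j\<in>{1..k}. P i j \<in> {0..1}) \<and> (\<exists>j\<in>{1..k}. P i j = X ! (i - 1))"
    if "i \<in> {1..length X}" for i
    using P(2)[of "i - 1"] that by (cases i) auto
  then have "valid_solution k X P"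
    unfolding valid_solution_def using P(1) by simp
  moreover have "cost k X P \<le> B"
    using P(3) by (simp add: cost_def sum.atLeast1_atMost_eq)
  moreover have "bdd_below {cost k X p | p. valid_solution k X p}"
    by (intro bdd_belowI[of _ 0]) (auto simp: cost_def intro!: sum_nonneg)
  ultimately show ?thesis
    unfolding OPT_def by (intro cInf_lower2[of "cost k X P"]) auto
qed

text \<open>A word with at most one entry imposes no comparison. Only words of length at least 2
  remain, for which the bounds on the limit are available.\<close>

lemma seq_contains_short:
  assumes "length \<pi> \<le> 1" "X \<noteq> []"
  shows "seq_contains X \<pi>"
proof -
  have "subseq (take (length \<pi>) X) X"
    by (intro prefix_imp_subseq take_is_prefix)
  moreover have "order_isomorphic (take (length \<pi>) X) \<pi>"
    unfolding order_isomorphic_def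
  proof (intro conjI allI impI)
    show len: "length (take (length \<pi>) X) = length \<pi>"
      using assms by (cases X) auto
    fix i j assume "i < length (take (length \<pi>) X)" "j < length (take (length \<pi>) X)"
    then have "i = j"
      using assms(1) len by linarith
    then show "take (length \<pi>) X ! i < take (length \<pi>) X ! j \<longleftrightarrow> \<pi> ! i < \<pi> ! j"
      by simp
  qed
  ultimately show ?thesis
    unfolding seq_contains_def by blast
qed

section \<open>Choice of the parameters\<close>

text \<open>Both sides equal \<open>exp (ln x * ln y / ln b)\<close>.\<close>

lemma powr_log_swap:
  fixes b x y :: real
  assumes "0 < x" "0 < y"
  shows "x powr log b y = y powr log b x"
  using assms by (simp add: powr_def log_def)

text \<open>\<open>L\<close> levels need \<open>q ^ L \<le> b ^ L \<le> k\<close> servers. With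
  \<open>s\<close> equal to \<open>y\<close> rounded up, the term \<open>n / s ^ L\<close> is at
  most \<open>y\<close> and the other at most \<open>2 * y\<close> times the power of
  \<open>k\<close>, which explains the constant 3.\<close>

lemma OPT_le_powr:
  assumes pi: "distinct \<pi>" "set \<pi> = {1..length \<pi>}" "2 \<le> length \<pi>"
    and k: "1 \<le> k" and X: "set X \<subseteq> {0..1}" "seq_avoids X \<pi>" "X \<noteq> []"
    and b: "b = 5 * fh_limit \<pi>" and y: "y = real (length X) powr (1 / (real_of_int \<lfloor>log b (real k)\<rfloor> + 1))"
  shows "OPT k X \<le> 3 * (real k powr (1 + log b 120) * y)"
proof -
  define c where "c = fh_limit \<pi>"
  define q where "q = nat \<lfloor>c\<rfloor> + 1"
  define L where "L = nat \<lfloor>log b (real k)\<rfloor>"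
  define n where "n = length X"
  define s where "s = nat \<lceil>y\<rceil>"
  have c1: "1 \<le> c"
    unfolding c_def by (rule fh_limit_ge_1[OF pi])
  \<comment> \<open>\<open>q\<close> is the least integer above \<open>c\<close>, and
    \<open>1 \<le> c\<close> gives \<open>q \<le> c + 1 \<le> 5 * c = b\<close>.\<close>
  have q_gt: "c < real q" and q_le: "real q \<le> b"
    using c1 b unfolding q_def c_def by linarith+
  have b1: "1 < b"
    using c1 b c_def by simp
  have log0: "0 \<le> log b (real k)"
    using b1 k by simp
  then have L: "real_of_int \<lfloor>log b (real k)\<rfloor> = real L" "real L \<le> log b (real k)"
    unfolding L_def by (simp_all add: of_nat_nat)
  have "real q ^ L \<le> b ^ L"
    using q_le by (rule power_mono) simp
  also have "\<dots> = b powr real L"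
    using b1 by (simp add: powr_realpow)
  also have "\<dots> \<le> b powr log b (real k)"
    using b1 L(2) by (intro powr_mono) auto
  also have "\<dots> = real k"
    using b1 k by simp
  finally have qL: "real q ^ L \<le> real k" .
  have n1: "1 \<le> real n"
    using X(3) by (cases X) (auto simp: n_def)
  have y_def: "y = real n powr (1 / (real L + 1))"
    using y L(1) by (simp add: n_def)
  have y1: "1 \<le> y"
    unfolding y_def using n1 by (simp add: ge_one_powr_ge_zero)
  have ypow: "y ^ L * y = real n"
  proof -
    have "y ^ Suc L = y powr real (Suc L)"
      using y1 powr_realpow[of y "Suc L"] by (simp del: power_Suc)
    also have "\<dots> = real n powr 1"
      unfolding y_def by (simp add: powr_powr add.commute)
    finally show ?thesis
      using n1 by (simp add: mult.commute)
  qed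
  \<comment> \<open>Since \<open>1 \<le> y\<close>, rounding up at most doubles
    \<open>y\<close>.\<close>
  have s: "y \<le> real s" "real s \<le> 2 * y" "0 < s"
    using y1 unfolding s_def by linarith+
  have ex_less: "ex \<pi> t < q * t" if "0 < t" for t
  proof -
    have "real (ex \<pi> t) \<le> c * real t"
      unfolding c_def by (rule ex_le_fh_limit[OF pi])
    also have "\<dots> < real q * real t"
      using q_gt that by simp
    finally show ?thesis
      by (metis of_nat_less_iff of_nat_mult)
  qed
  have "servable {1..q ^ L} {0..0 + 1} (\<lambda>_. 0) X
      (1 * (real (length X) / real s ^ L + (4 * real q) ^ L * real s))"
    using X by (intro servable_level[OF pi(1,2) ex_less]) (auto simp: q_def s(3))
  then have "servable {1..q ^ L} {0..1} (\<lambda>_. 0) X (real n / real s ^ L + (4 * real q) ^ L * real s)"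
    by (simp add: n_def)
  \<comment> \<open>Only the first \<open>q ^ L\<close> servers work; the others stay at 0.\<close>
  moreover have "{1..q ^ L} \<subseteq> {1..k}"
    using qL by (simp flip: of_nat_power)
  ultimately have "servable {1..k} {0..1} (\<lambda>_. 0) X (real n / real s ^ L + (4 * real q) ^ L * real s)"
    by (rule servable_superset) simp_all
  then have "OPT k X \<le> real n / real s ^ L + (4 * real q) ^ L * real s"
    by (rule OPT_le_servable)
  also have "real n / real s ^ L \<le> 1 * y"
  proof -
    have "real n \<le> real s ^ L * y"
      unfolding ypow[symmetric] using s(1) y1 by (intro mult_right_mono power_mono) auto
    then show ?thesis
      using s(3) by (simp add: divide_le_eq mult.commute)
  qed
  also have "(4 * real q) ^ L * real s \<le> real k powr (1 + log b 120) * (2 * y)"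
  proof (intro mult_mono s(2))
    \<comment> \<open>Beside \<open>q ^ L \<le> k\<close> only \<open>4 ^ L\<close> remains;
      enlarging the base to 120 and swapping base and argument produces the exponent
      \<open>log b 120\<close> of \<open>k\<close>.\<close>
    have "(4::real) ^ L \<le> 120 ^ L"
      by (rule power_mono) auto
    also have "\<dots> = 120 powr real L"
      by (simp add: powr_realpow)
    also have "\<dots> \<le> 120 powr log b (real k)"
      using L(2) by (intro powr_mono) auto
    also have "\<dots> = real k powr log b 120"
      using k by (intro powr_log_swap) auto
    finally have "4 ^ L * real q ^ L \<le> real k powr log b 120 * real k"
      using qL by (intro mult_mono) auto
    also have "\<dots> = real k powr (1 + log b 120)"
      using k by (simp add: powr_add mult.commute)
    finally show "(4 * real q) ^ L \<le> real k powr (1 + log b 120)"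
      by (simp add: power_mult_distrib)
  qed auto
  also have "1 * y \<le> real k powr (1 + log b 120) * y"
    using y1 k b1 by (intro mult_right_mono ge_one_powr_ge_zero) auto
  finally show ?thesis
    by (simp add: mult.commute)
qed

theorem theorem3p7:
  shows "\<exists>C::real. \<forall>(m::nat) (\<pi>::nat list) (k::nat) (n::nat) (X::real list).
    \<pi> \<in> permutations_of_set {1..m} \<longrightarrow> k \<ge> 1 \<longrightarrow>
    length X = n \<longrightarrow> set X \<subseteq> {0..1} \<longrightarrow> distinct X \<longrightarrow> seq_avoids X \<pi> \<longrightarrow>
    OPT k X \<le> C * (real k powr (1 + log (5 * fh_limit \<pi>) 120)
      * real n powr (1 / (real_of_int \<lfloor>log (5 * fh_limit \<pi>) (real k)\<rfloor> + 1)))"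
proof (intro exI[of _ 3] allI impI)
  fix m k n :: nat and \<pi> :: "nat list" and X :: "real list"
  assume \<pi>: "\<pi> \<in> permutations_of_set {1..m}" and k: "1 \<le> k" and n: "length X = n"
    and X: "set X \<subseteq> {0..1}" "seq_avoids X \<pi>"
  have "length \<pi> = m"
    using \<pi> length_finite_permutations_of_set by fastforce
  then have pi: "distinct \<pi>" "set \<pi> = {1..length \<pi>}"
    using permutations_of_setD[OF \<pi>] by simp_all
  show "OPT k X \<le> 3 * (real k powr (1 + log (5 * fh_limit \<pi>) 120)
      * real n powr (1 / (real_of_int \<lfloor>log (5 * fh_limit \<pi>) (real k)\<rfloor> + 1)))"
  \<comment> \<open>For the empty input nothing has to be served and the bound is 0, as
    \<open>0 powr _\<close> is 0. A nonempty input that avoids \<open>\<pi>\<close> forces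
    \<open>\<pi>\<close> to have length at least 2.\<close>
  proof (cases "X = []")
    case True
    then have "OPT k X \<le> 0"
      by (intro OPT_le_servable) simp
    then show ?thesis
      using True n by simp
  next
    case False
    then have "2 \<le> length \<pi>"
      using seq_contains_short[of \<pi> X] X(2) unfolding seq_avoids_def by linarith
    then show ?thesis
      using OPT_le_powr[OF pi _ k X False refl refl] n by simp
  qed
qed

end
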